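(* Let $m\ge2$. The canonical solution operator $S_m:A^2(\mathbb C,e^{-|z|^m})\to L^2(\mathbb C,e^{-|z|^m})$ to $\overline\partial$ is compact if and only if $$\lim_{k\to\infty}\left(\frac{c_{k+1}^2}{c_k^2}-\frac{c_k^2}{c_{k-1}^2}\right)=0,$$ where $c_k^2=\int_{\mathbb C}|z|^{2k}e^{-|z|^m}\,d\lambda(z)$.
   Context: For $m>0$, $L^2(\mathbb C,e^{-|z|^m})$ is the space of measurable $u$ with $\int_{\mathbb C}|u|^2e^{-|z|^m}d\lambda<\infty$ ($d\lambda$ Lebesgue measure), and $A^2(\mathbb C,e^{-|z|^m})$ its closed subspace of entire functions. The canonical solution operator $S_m$ assigns to $f\in A^2(\mathbb C,e^{-|z|^m})$ the unique $u\in L^2(\mathbb C,e^{-|z|^m})$ with $\overline\partial u=f$ and $u\perp A^2(\mathbb C,e^{-|z|^m})$ (for $m\ge2$ this is a bounded operator). *)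

theory Defs
  imports "HOL-Analysis.Analysis"
begin

definition wt :: "real \<Rightarrow> complex \<Rightarrow> real" where
  "wt m z = exp (- (norm z powr m))"

definition L2w :: "real \<Rightarrow> (complex \<Rightarrow> complex) \<Rightarrow> bool" where
  "L2w m u \<longleftrightarrow> u \<in> borel_measurable lebesgue \<and>
      integrable lebesgue (\<lambda>z. (norm (u z))\<^sup>2 * wt m z)"

definition normsq :: "real \<Rightarrow> (complex \<Rightarrow> complex) \<Rightarrow> real" where
  "normsq m u = integral\<^sup>L lebesgue (\<lambda>z. (norm (u z))\<^sup>2 * wt m z)"

definition inner_w :: "real \<Rightarrow> (complex \<Rightarrow> complex) \<Rightarrow> (complex \<Rightarrow> complex) \<Rightarrow> complex" where
  "inner_w m u g = integral\<^sup>L lebesgue (\<lambda>z. u z * cnj (g z) * complex_of_real (wt m z))"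

definition A2w :: "real \<Rightarrow> (complex \<Rightarrow> complex) \<Rightarrow> bool" where
  "A2w m f \<longleftrightarrow> f holomorphic_on UNIV \<and> L2w m f"

fun pderivs :: "complex list \<Rightarrow> (complex \<Rightarrow> complex) \<Rightarrow> complex \<Rightarrow> complex" where
  "pderivs [] \<phi> = \<phi>"
| "pderivs (v # vs) \<phi> = (\<lambda>z. frechet_derivative (pderivs vs \<phi>) (at z) v)"

definition test_fun :: "(complex \<Rightarrow> complex) \<Rightarrow> bool" where
  "test_fun \<phi> \<longleftrightarrow> (\<forall>vs \<in> lists {1, \<i>}. \<forall>z. pderivs vs \<phi> differentiable (at z))
      \<and> compact (closure {z. \<phi> z \<noteq> 0})"

definition dbar :: "(complex \<Rightarrow> complex) \<Rightarrow> complex \<Rightarrow> complex" where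
  "dbar \<phi> z = (frechet_derivative \<phi> (at z) 1 + \<i> * frechet_derivative \<phi> (at z) \<i>) / 2"

definition weak_dbar :: "(complex \<Rightarrow> complex) \<Rightarrow> (complex \<Rightarrow> complex) \<Rightarrow> bool" where
  "weak_dbar u f \<longleftrightarrow> (\<forall>\<phi>. test_fun \<phi> \<longrightarrow>
      integral\<^sup>L lebesgue (\<lambda>z. u z * dbar \<phi> z) = - integral\<^sup>L lebesgue (\<lambda>z. f z * \<phi> z))"

definition canonical_sol :: "real \<Rightarrow> (complex \<Rightarrow> complex) \<Rightarrow> (complex \<Rightarrow> complex) \<Rightarrow> bool" where
  "canonical_sol m f u \<longleftrightarrow> L2w m u \<and> weak_dbar u f \<and> (\<forall>g. A2w m g \<longrightarrow> inner_w m u g = 0)"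

text \<open>Compactness of S_m: images of bounded sequences in A^2 have L^2-Cauchy subsequences.
  (Canonical solutions are unique up to a.e. equality, so this is compactness of the operator.)\<close>
definition Sm_compact :: "real \<Rightarrow> bool" where
  "Sm_compact m \<longleftrightarrow> (\<forall>(f :: nat \<Rightarrow> complex \<Rightarrow> complex) u. (\<forall>n. A2w m (f n) \<and> canonical_sol m (f n) (u n)) \<and>
        (\<exists>B. \<forall>n. normsq m (f n) \<le> B) \<longrightarrow>
      (\<exists>r :: nat \<Rightarrow> nat. strict_mono r \<and> (\<forall>e>0. \<exists>N. \<forall>i\<ge>N. \<forall>j\<ge>N.
          normsq m (\<lambda>z. u (r i) z - u (r j) z) < e)))"

definition csq :: "real \<Rightarrow> nat \<Rightarrow> real" where
  "csq m k = integral\<^sup>L lebesgue (\<lambda>z. norm z ^ (2 * k) * wt m z)"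

end

theory Submission
  imports Defs "HOL-Complex_Analysis.Complex_Analysis"
begin

text \<open>
  Write \<open>U\<^sub>k = cnj z * z ^ k - rho k * z ^ (k - 1)\<close> with \<open>rho k = c\<^sub>k\<^sup>2 / c\<^sub>k\<^sub>-\<^sub>1\<^sup>2\<close>. By rotation
  invariance of Lebesgue measure the \<open>U\<^sub>k\<close> are pairwise orthogonal and orthogonal to the weighted
  Bergman space, so \<open>U\<^sub>k\<close> is the canonical solution for \<open>z ^ k\<close>, and
  \<open>\<parallel>U\<^sub>k\<parallel>\<^sup>2 = c\<^sub>k\<^sup>2 * lam k\<close> with \<open>lam k = rho (k + 1) - rho k\<close>. Hence the solution operator is
  diagonal with respect to orthonormal systems, with singular values \<open>sqrt (lam k)\<close>.

  If it is compact, the images of the normalised monomials along a subsequence with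
  \<open>lam k \<ge> e > 0\<close> would stay at distance at least \<open>sqrt (2 * e)\<close> from each other, a contradiction.

  Conversely, for \<open>f = (\<Sum>k. a k * z ^ k)\<close> the function
  \<open>v = cnj z * f - (\<Sum>k. a k * rho k * z ^ (k - 1))\<close> solves the equation and satisfies
  \<open>\<parallel>v\<parallel>\<^sup>2 \<le> (\<Sum>k. \<bar>a k\<bar>\<^sup>2 * c\<^sub>k\<^sup>2 * lam k)\<close> by Fatou's lemma. The canonical solution has the least norm
  among all weak solutions, because the difference of two of them is entire by Weyl's lemma. If
  \<open>lam\<close> tends to zero, this bound and Bessel's inequality make the images of a bounded sequence
  Cauchy along any subsequence on which every Taylor coefficient converges.
\<close>


section \<open>Rotation invariance of planar Lebesgue measure\<close>

text \<open>\<open>canonical_sol\<close> pins u down only up to null sets, through a weak equation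
  and orthogonality to an infinite-dimensional space, and \<open>Sm_compact\<close> speaks of
  arbitrary such u. The converse therefore works with an explicit competitor and a norm comparison;
  an inequality is enough, because compactness only asks for small differences. Weyl's lemma is what
  turns the weak equation into something comparable.

  The second obstacle is exchanging sums and integrals over the plane, since the Taylor series of f
  is not known to converge in the weighted norm. Rotation averaging is carried out on discs, where
  the series converges uniformly, and only single coefficients or norm bounds are passed to the
  limit.

  The number rho k makes the second term of U_k the orthogonal projection of cnj z * z ^ k: both
  terms have the same inner product with every entire function of the space. When \<open>lam\<close>
  is bounded, its telescoping sum \<open>rho\<close> grows at most linearly, so the correcting power
  series of the competitor is again entire.\<close>

lemma measurable_Complex [measurable]:
  "(\<lambda>p. Complex (fst p) (snd p)) \<in> borel_measurable (borel \<Otimes>\<^sub>M borel)"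
proof -
  have "(\<lambda>p. complex_of_real (fst p) + \<i> * complex_of_real (snd p)) \<in> borel_measurable (borel \<Otimes>\<^sub>M borel)"
    by measurable
  then show ?thesis
    by (simp add: Complex_eq)
qed

text \<open>Lebesgue measure is determined by the masses of boxes, and a box of complex numbers is a
  product of two real intervals. This opens the way to iterated real integrals.\<close>

lemma lborel_complex_eq_distr:
  "lborel = distr (lborel \<Otimes>\<^sub>M lborel) borel (\<lambda>p. Complex (fst p) (snd p))"
proof (rule lborel_eqI)
  fix l u :: complex
  assume le: "\<And>b. b \<in> Basis \<Longrightarrow> l \<bullet> b \<le> u \<bullet> b"
  have le': "Re l \<le> Re u" "Im l \<le> Im u"
    using le[of 1] le[of \<i>] by (auto simp: Basis_complex_def)
  have eq: "(\<lambda>p. Complex (fst p) (snd p)) -` box l u \<inter> space (lborel \<Otimes>\<^sub>M lborel)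
      = {Re l<..<Re u} \<times> {Im l<..<Im u}"
    by (auto simp: box_def Basis_complex_def space_pair_measure)
  show "emeasure (distr (lborel \<Otimes>\<^sub>M lborel) borel (\<lambda>p. Complex (fst p) (snd p))) (box l u)
      = (\<Prod>b\<in>Basis. (u - l) \<bullet> b)"
    using le' by (subst emeasure_distr)
      (auto simp: eq lborel.emeasure_pair_measure_Times Basis_complex_def ennreal_mult)
qed simp

lemma nn_integral_lborel_complex:
  assumes [measurable]: "f \<in> borel_measurable borel"
  shows "(\<integral>\<^sup>+z. f z \<partial>lborel) = (\<integral>\<^sup>+x. \<integral>\<^sup>+y. f (Complex x y) \<partial>lborel \<partial>lborel)"
    and "(\<integral>\<^sup>+z. f z \<partial>lborel) = (\<integral>\<^sup>+y. \<integral>\<^sup>+x. f (Complex x y) \<partial>lborel \<partial>lborel)"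
proof -
  have "(\<integral>\<^sup>+z. f z \<partial>lborel) = (\<integral>\<^sup>+p. f (Complex (fst p) (snd p)) \<partial>(lborel \<Otimes>\<^sub>M lborel))"
    by (subst lborel_complex_eq_distr, subst nn_integral_distr) auto
  then show "(\<integral>\<^sup>+z. f z \<partial>lborel) = (\<integral>\<^sup>+x. \<integral>\<^sup>+y. f (Complex x y) \<partial>lborel \<partial>lborel)"
    by (subst (asm) lborel.nn_integral_fst[symmetric]) auto
  then show "(\<integral>\<^sup>+z. f z \<partial>lborel) = (\<integral>\<^sup>+y. \<integral>\<^sup>+x. f (Complex x y) \<partial>lborel \<partial>lborel)"
    by (subst lborel_pair.Fubini'[where f="\<lambda>x y. f (Complex x y)"]) (auto simp: case_prod_beta)
qed

lemma nn_integral_lborel_translate: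
  fixes f :: "'a::euclidean_space \<Rightarrow> ennreal"
  assumes [measurable]: "f \<in> borel_measurable borel"
  shows "(\<integral>\<^sup>+x. f (c + x) \<partial>lborel) = (\<integral>\<^sup>+x. f x \<partial>lborel)"
  by (subst (2) lborel_distr_plus[of c, symmetric], subst nn_integral_distr) auto

text \<open>With the real part integrated first, the shear acts on each horizontal line as a
  translation by the constant \<open>a * Im z\<close>.\<close>

lemma nn_integral_shear_Re:
  assumes [measurable]: "f \<in> borel_measurable borel"
  shows "(\<integral>\<^sup>+z. f (Complex (Re z + a * Im z) (Im z)) \<partial>lborel) = (\<integral>\<^sup>+z. f z \<partial>lborel)"
proof -
  have [measurable]: "(\<lambda>z. Complex (Re z + a * Im z) (Im z)) \<in> borel_measurable borel"
    unfolding Complex_eq by measurable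
  have [measurable]: "(\<lambda>x. Complex x y) \<in> borel_measurable borel" for y
    unfolding Complex_eq by measurable
  have "(\<integral>\<^sup>+x. f (Complex (a * y + x) y) \<partial>lborel) = (\<integral>\<^sup>+x. f (Complex x y) \<partial>lborel)" for y
    by (rule nn_integral_lborel_translate[of "\<lambda>x. f (Complex x y)"]) measurable
  then show ?thesis
    by (simp add: nn_integral_lborel_complex(2) add.commute)
qed

lemma nn_integral_shear_Im:
  assumes [measurable]: "f \<in> borel_measurable borel"
  shows "(\<integral>\<^sup>+z. f (Complex (Re z) (Im z + a * Re z)) \<partial>lborel) = (\<integral>\<^sup>+z. f z \<partial>lborel)"
proof -
  have [measurable]: "(\<lambda>z. Complex (Re z) (Im z + a * Re z)) \<in> borel_measurable borel"
    unfolding Complex_eq by measurable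
  have [measurable]: "(\<lambda>y. Complex x y) \<in> borel_measurable borel" for x
    unfolding Complex_eq by measurable
  have "(\<integral>\<^sup>+y. f (Complex x (a * x + y)) \<partial>lborel) = (\<integral>\<^sup>+y. f (Complex x y) \<partial>lborel)" for x
    by (rule nn_integral_lborel_translate[of "\<lambda>y. f (Complex x y)"]) measurable
  then show ?thesis
    by (simp add: nn_integral_lborel_complex(1) add.commute)
qed

text \<open>A rotation other than the point reflection is a product of three shears.\<close>

lemma nn_integral_rotate:
  fixes w :: complex
  assumes f: "f \<in> borel_measurable borel" and w: "norm w = 1"
  shows "(\<integral>\<^sup>+z. f (w * z) \<partial>lborel) = (\<integral>\<^sup>+z. f z \<partial>lborel)"
proof -
  have *: "(\<integral>\<^sup>+z. g (w * z) \<partial>lborel) = (\<integral>\<^sup>+z. g z \<partial>lborel)"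
    if w: "norm w = 1" "w \<noteq> -1" and [measurable]: "g \<in> borel_measurable borel"
    for g :: "complex \<Rightarrow> ennreal" and w
  proof -
    define c s where "c = Re w" and "s = Im w"
    have cs: "c\<^sup>2 + s\<^sup>2 = 1"
      using w(1) by (simp add: c_def s_def cmod_def)
    have "c \<noteq> -1"
      using w(2) cs by (auto simp: c_def s_def complex_eq_iff)
    then have c1: "1 + c \<noteq> 0" by linarith
    \<comment> \<open>For w = exp (i theta), t is tan (theta / 2). The rotation is the horizontal
      shear by -t, then the vertical one by s, then the horizontal one by -t again; at w = -1 the
      denominator vanishes.\<close>
    define t where "t = s / (1 + c)"
    have ts: "t * s = 1 - c" "t * (1 + c) = s"
      using c1 cs by (auto simp: t_def field_simps power2_eq_square)
    define A where "A z = Complex (Re z + (-t) * Im z) (Im z)" for z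
    define B where "B z = Complex (Re z) (Im z + s * Re z)" for z
    have [measurable]: "A \<in> borel_measurable borel" "B \<in> borel_measurable borel"
      unfolding A_def B_def Complex_eq by measurable
    have "A (B (A z)) = w * z" for z
    proof -
      have "Re (A (B (A z))) = Re z * (1 - t * s) - Im z * (t + t * (1 - t * s))"
        by (simp add: A_def B_def algebra_simps)
      also have "\<dots> = c * Re z - s * Im z"
        using ts by (simp add: distrib_left)
      finally have "Re (A (B (A z))) = Re (w * z)"
        by (simp add: c_def s_def)
      moreover have "Im (A (B (A z))) = Im z * (1 - t * s) + s * Re z"
        by (simp add: A_def B_def algebra_simps)
      ultimately show ?thesis
        using ts by (simp add: complex_eq_iff c_def s_def)
    qed
    then have "(\<integral>\<^sup>+z. g (w * z) \<partial>lborel) = (\<integral>\<^sup>+z. g (A (B (A z))) \<partial>lborel)" by simp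
    also have "\<dots> = (\<integral>\<^sup>+z. g (A (B z)) \<partial>lborel)"
      by (rule nn_integral_shear_Re[where f="\<lambda>z. g (A (B z))" and a="-t", folded A_def]) measurable
    also have "\<dots> = (\<integral>\<^sup>+z. g (A z) \<partial>lborel)"
      unfolding B_def by (rule nn_integral_shear_Im[where f="\<lambda>z. g (A z)"]) measurable
    also have "\<dots> = (\<integral>\<^sup>+z. g z \<partial>lborel)"
      unfolding A_def by (rule nn_integral_shear_Re) measurable
    finally show ?thesis .
  qed
  show ?thesis
  proof (cases "w = -1")
    \<comment> \<open>The point reflection is the square of the rotation by \<open>\<i>\<close>, to
      which the shear argument applies.\<close>
    case True
    have "(\<integral>\<^sup>+z. f (\<i> * (\<i> * z)) \<partial>lborel) = (\<integral>\<^sup>+z. f (\<i> * z) \<partial>lborel)"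
      using f by (intro *[of \<i> "\<lambda>z. f (\<i> * z)"]) (auto simp: complex_eq_iff)
    also have "\<dots> = (\<integral>\<^sup>+z. f z \<partial>lborel)"
      using f by (intro *[of \<i> f]) (auto simp: complex_eq_iff)
    finally show ?thesis
      using True by (simp flip: mult.assoc)
  qed (use * f w in auto)
qed

lemma lborel_distr_rotate:
  fixes w :: complex
  assumes w: "norm w = 1"
  shows "distr lborel borel ((*) w) = lborel"
proof (rule measure_eqI)
  fix X assume "X \<in> sets (distr lborel borel ((*) w))"
  then have [measurable]: "X \<in> sets borel" by simp
  have "emeasure (distr lborel borel ((*) w)) X = (\<integral>\<^sup>+z. indicator X z \<partial>distr lborel borel ((*) w))"
    by simp
  also have "\<dots> = (\<integral>\<^sup>+z. indicator X (w * z) \<partial>lborel)"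
    by (subst nn_integral_distr) auto
  also have "\<dots> = (\<integral>\<^sup>+z. indicator X z \<partial>lborel)"
    using w by (intro nn_integral_rotate) auto
  finally show "emeasure (distr lborel borel ((*) w)) X = emeasure lborel X" by simp
qed simp

lemma integral_lborel_rotate:
  fixes w :: complex and f :: "complex \<Rightarrow> 'b::{banach, second_countable_topology}"
  assumes "f \<in> borel_measurable borel" "norm w = 1"
  shows "(\<integral>z. f (w * z) \<partial>lborel) = (\<integral>z. f z \<partial>lborel)"
  using assms by (subst (2) lborel_distr_rotate[of w, symmetric]) (auto simp: integral_distr)

lemma integral_lborel_translate:
  fixes f :: "'a::euclidean_space \<Rightarrow> 'b::{banach, second_countable_topology}"
  assumes "f \<in> borel_measurable borel"
  shows "(\<integral>x. f (c + x) \<partial>lborel) = (\<integral>x. f x \<partial>lborel)"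
  using assms by (subst (2) lborel_distr_plus[of c, symmetric]) (auto simp: integral_distr)

lemma integrable_lborel_translate:
  fixes f :: "'a::euclidean_space \<Rightarrow> 'b::{banach, second_countable_topology}"
  assumes "integrable lborel f"
  shows "integrable lborel (\<lambda>x. f (c + x))"
proof -
  have "integrable (distr lborel borel ((+) c)) f"
    using assms by (simp add: lborel_distr_plus)
  then show ?thesis
    using assms by (subst (asm) integrable_distr_eq) (auto dest: borel_measurable_integrable)
qed

text \<open>Substituting w * z for z shows that the integral equals c times itself.\<close>

lemma integral_eq_0_if_rotation_eigenfunction:
  fixes F :: "complex \<Rightarrow> complex"
  assumes F: "F \<in> borel_measurable borel" and w: "norm w = 1" and c: "c \<noteq> 1"
    and eig: "\<And>z. F (w * z) = c * F z"
  shows "(\<integral>z. F z \<partial>lborel) = 0"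
proof -
  have "(\<integral>z. F z \<partial>lborel) = (\<integral>z. c * F z \<partial>lborel)"
    using integral_lborel_rotate[OF F w] eig by simp
  then have "(1 - c) * (\<integral>z. F z \<partial>lborel) = 0"
    by (simp add: algebra_simps)
  with c show ?thesis by simp
qed

lemma ex_unit_power_neq:
  assumes "k \<noteq> (n::nat)"
  obtains w :: complex where "norm w = 1" "w ^ k * cnj w ^ n \<noteq> 1"
proof -
  define d where "d = real k - real n"
  have d: "d \<noteq> 0" using assms by (simp add: d_def)
  \<comment> \<open>The angle is chosen so that the product of the two powers turns by exactly pi,
    whatever the sign of \<open>d\<close>.\<close>
  define w where "w = cis (pi / d)"
  have "w ^ k * cnj w ^ n = cis (real k * (pi / d)) * cis (real n * (- (pi / d)))"
    by (simp only: w_def cis_cnj Complex.DeMoivre)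
  also have "\<dots> = cis ((real k - real n) * (pi / d))"
    by (simp add: cis_mult left_diff_distrib diff_divide_distrib)
  also have "\<dots> = cis pi"
    using d by (simp flip: d_def)
  finally show ?thesis
    by (intro that[of w]) (auto simp: w_def)
qed

section \<open>Power series and radial weights\<close>

lemma borel_measurable_cnj [measurable]: "cnj \<in> borel_measurable borel"
  by (intro borel_measurable_continuous_onI continuous_intros)

lemma powser_entire_abs_summable:
  fixes a :: "nat \<Rightarrow> complex"
  assumes "\<And>z. summable (\<lambda>k. a k * z ^ k)" and "r \<ge> 0"
  shows "summable (\<lambda>k. norm (a k) * r ^ k)"
proof -
  have "summable (\<lambda>k. norm (a k * complex_of_real r ^ k))"
    by (rule powser_insidea[of a "complex_of_real (r + 1)"]) (use assms in auto)
  then show ?thesis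
    using assms(2) by (simp add: norm_mult norm_power)
qed

lemma power_mult_cnj: "z ^ n * cnj z ^ n = complex_of_real (norm z) ^ (2 * n)"
  by (simp only: power_mult complex_norm_square of_real_power[symmetric] power_mult_distrib)

text \<open>On the bounded support of \<open>R\<close> the power series is dominated by a convergent
  numerical series, which permits termwise integration. Each term with k \<noteq> n is multiplied by
  a factor other than 1 under a suitable rotation, so only the n-th integral survives.\<close>

lemma integral_powser_radial_bounded:
  fixes a :: "nat \<Rightarrow> complex" and R :: "complex \<Rightarrow> real"
  assumes G: "\<And>z. (\<lambda>k. a k * z ^ k) sums G z"
    and radial: "\<And>w z. norm w = 1 \<Longrightarrow> R (w * z) = R z"
    and int: "integrable lborel R"
    and supp: "\<And>z. norm z > r \<Longrightarrow> R z = 0" and r: "r \<ge> 0"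
  shows "(\<integral>z. G z * cnj z ^ n * R z \<partial>lborel) = a n * (\<integral>z. norm z ^ (2 * n) * R z \<partial>lborel)"
proof -
  have [measurable]: "R \<in> borel_measurable borel"
    using borel_measurable_integrable[OF int] by simp
  define f where "f k z = a k * z ^ k * cnj z ^ n * R z" for k z
  have [measurable]: "f k \<in> borel_measurable borel" for k
    unfolding f_def by measurable
  have bound: "norm (f k z) \<le> norm (a k) * r ^ k * (r ^ n * norm (R z))" for k z
  proof (cases "norm z > r")
    case False
    then have "norm z ^ k * norm z ^ n \<le> r ^ k * r ^ n"
      by (intro mult_mono power_mono) (use r in auto)
    from mult_left_mono[OF mult_right_mono[OF this, of "norm (R z)"], of "norm (a k)"] show ?thesis
      by (simp add: f_def norm_mult norm_power mult_ac)
  qed (auto simp: f_def supp r)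
  have int_f: "integrable lborel (f k)" for k
  proof (rule Bochner_Integration.integrable_bound)
    show "integrable lborel (\<lambda>z. norm (a k) * r ^ k * (r ^ n * norm (R z)))"
      using int by auto
    show "AE z in lborel. norm (f k z) \<le> norm (norm (a k) * r ^ k * (r ^ n * norm (R z)))"
      by (intro AE_I2 order_trans[OF bound]) simp
  qed auto
  have sum_ar: "summable (\<lambda>k. norm (a k) * r ^ k)"
    using G r by (intro powser_entire_abs_summable) (auto simp: sums_iff)
  have sums1: "(\<lambda>k. integral\<^sup>L lborel (f k)) sums (\<integral>z. (\<Sum>k. f k z) \<partial>lborel)"
  proof (rule sums_integral[OF int_f])
    show "AE z in lborel. summable (\<lambda>k. norm (f k z))"
      using bound by (intro AE_I2 summable_comparison_test'[OF summable_mult2[OF sum_ar]]) auto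
    have "(\<integral>z. norm (f k z) \<partial>lborel) \<le> (\<integral>z. norm (a k) * r ^ k * (r ^ n * norm (R z)) \<partial>lborel)" for k
      using bound int_f int by (intro integral_mono) auto
    then have "(\<integral>z. norm (f k z) \<partial>lborel) \<le> norm (a k) * r ^ k * (r ^ n * (\<integral>z. norm (R z) \<partial>lborel))" for k
      by simp
    then show "summable (\<lambda>k. \<integral>z. norm (f k z) \<partial>lborel)"
      by (intro summable_comparison_test'[OF summable_mult2[OF sum_ar]]) auto
  qed
  have zero: "integral\<^sup>L lborel (f k) = 0" if kn: "k \<noteq> n" for k
  proof -
    obtain w :: complex where w: "norm w = 1" "w ^ k * cnj w ^ n \<noteq> 1"
      using ex_unit_power_neq[OF kn] .
    show ?thesis
      by (rule integral_eq_0_if_rotation_eigenfunction[OF _ w])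
        (auto simp: f_def radial[OF w(1)] power_mult_distrib)
  qed
  have "(\<lambda>k. integral\<^sup>L lborel (f k)) sums integral\<^sup>L lborel (f n)"
    using sums_finite[of "{n}" "\<lambda>k. integral\<^sup>L lborel (f k)"] zero by simp
  with sums1 have "(\<integral>z. (\<Sum>k. f k z) \<partial>lborel) = integral\<^sup>L lborel (f n)"
    by (rule sums_unique2)
  moreover have "(\<Sum>k. f k z) = G z * cnj z ^ n * R z" for z
    unfolding f_def using sums_mult2[OF sums_mult2[OF G[of z], of "cnj z ^ n"], of "R z"] by (simp add: sums_iff)
  moreover have "f n = (\<lambda>z. a n * of_real (norm z ^ (2 * n) * R z))"
    by (auto simp: fun_eq_iff f_def mult.assoc simp flip: power_mult_cnj)
  ultimately show ?thesis
    by (simp only: integral_mult_right_zero integral_complex_of_real)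
qed

text \<open>On the whole plane the terms of the series need not have a common integrable majorant.
  Cutting \<open>R\<close> off outside discs reduces to bounded support, and dominated convergence,
  with the two full integrands as majorants, removes the cutoff.\<close>

lemma integral_powser_radial:
  fixes a :: "nat \<Rightarrow> complex" and R :: "complex \<Rightarrow> real"
  assumes G: "\<And>z. (\<lambda>k. a k * z ^ k) sums G z"
    and radial: "\<And>w z. norm w = 1 \<Longrightarrow> R (w * z) = R z"
    and R: "integrable lborel R"
    and intG: "integrable lborel (\<lambda>z. G z * cnj z ^ n * R z)"
    and intR: "integrable lborel (\<lambda>z. norm z ^ (2 * n) * R z)"
  shows "(\<integral>z. G z * cnj z ^ n * R z \<partial>lborel) = a n * (\<integral>z. norm z ^ (2 * n) * R z \<partial>lborel)"
proof -
  define I :: "nat \<Rightarrow> complex \<Rightarrow> real" where "I j = indicator (cball 0 (real j))" for j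
  have [measurable]: "I j \<in> borel_measurable borel" for j
    unfolding I_def by (intro borel_measurable_indicator borel_closed closed_cball)
  have [measurable]: "R \<in> borel_measurable borel"
    using borel_measurable_integrable[OF R] by simp
  have [measurable]: "(\<lambda>z. G z * cnj z ^ n * R z) \<in> borel_measurable borel"
    using borel_measurable_integrable[OF intG] by simp
  have ev: "\<forall>\<^sub>F j in sequentially. I j z = 1" for z
    using eventually_ge_at_top[of "nat \<lceil>norm z\<rceil>"]
    by eventually_elim (auto simp: I_def)
  have lim1: "(\<lambda>j. \<integral>z. I j z *\<^sub>R (G z * cnj z ^ n * R z) \<partial>lborel) \<longlonglongrightarrow> (\<integral>z. G z * cnj z ^ n * R z \<partial>lborel)"
  proof (rule integral_dominated_convergence[where w="\<lambda>z. norm (G z * cnj z ^ n * R z)"])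
    show "AE z in lborel. (\<lambda>j. I j z *\<^sub>R (G z * cnj z ^ n * R z)) \<longlonglongrightarrow> G z * cnj z ^ n * R z"
    proof (intro AE_I2 tendsto_eventually)
      fix z show "\<forall>\<^sub>F j in sequentially. I j z *\<^sub>R (G z * cnj z ^ n * R z) = G z * cnj z ^ n * R z"
        using ev[of z] by eventually_elim simp
    qed
    show "(\<lambda>z. I j z *\<^sub>R (G z * cnj z ^ n * R z)) \<in> borel_measurable lborel" for j
      by (intro borel_measurable_scaleR) simp_all
  qed (use intG in \<open>auto simp: I_def split: split_indicator\<close>)
  have lim2: "(\<lambda>j. \<integral>z. I j z *\<^sub>R (norm z ^ (2 * n) * R z) \<partial>lborel) \<longlonglongrightarrow> (\<integral>z. norm z ^ (2 * n) * R z \<partial>lborel)"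
  proof (rule integral_dominated_convergence[where w="\<lambda>z. norm (norm z ^ (2 * n) * R z)"])
    show "AE z in lborel. (\<lambda>j. I j z *\<^sub>R (norm z ^ (2 * n) * R z)) \<longlonglongrightarrow> norm z ^ (2 * n) * R z"
    proof (intro AE_I2 tendsto_eventually)
      fix z show "\<forall>\<^sub>F j in sequentially. I j z *\<^sub>R (norm z ^ (2 * n) * R z) = norm z ^ (2 * n) * R z"
        using ev[of z] by eventually_elim simp
    qed
    show "(\<lambda>z. I j z *\<^sub>R (norm z ^ (2 * n) * R z)) \<in> borel_measurable lborel" for j
      by (intro borel_measurable_scaleR) simp_all
  qed (use intR in \<open>auto simp: I_def split: split_indicator\<close>)
  have "(\<integral>z. G z * cnj z ^ n * (I j z * R z) \<partial>lborel) = a n * (\<integral>z. norm z ^ (2 * n) * (I j z * R z) \<partial>lborel)" for j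
  proof (rule integral_powser_radial_bounded[OF G, where r="real j"])
    show "integrable lborel (\<lambda>z. I j z * R z)"
      using integrable_mult_indicator[OF _ R, of "cball 0 (real j)"] by (simp add: I_def)
  qed (auto simp: I_def radial norm_mult split: split_indicator)
  then have eq: "(\<integral>z. I j z *\<^sub>R (G z * cnj z ^ n * R z) \<partial>lborel)
      = a n * (\<integral>z. I j z *\<^sub>R (norm z ^ (2 * n) * R z) \<partial>lborel)" for j
    by (simp add: mult_ac scaleR_conv_of_real)
  show ?thesis
    by (rule LIMSEQ_unique[OF lim1[unfolded eq]]) (intro tendsto_intros lim2)
qed

section \<open>Bump functions\<close>

text \<open>The negative powers of t next to the smooth function exp (-1 / t) make the family closed
  under differentiation: the derivative of member k combines the members k + 1 and k + 2.\<close>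

definition cutoff :: "nat \<Rightarrow> real \<Rightarrow> real" where
  "cutoff k t = (if t > 0 then exp (- 1 / t) / t ^ k else 0)"

lemma cutoff_nonneg: "0 \<le> cutoff k t"
  by (simp add: cutoff_def)

text \<open>A single term of the exponential series at 1 / t is at most the whole sum.\<close>

lemma cutoff_le_fact: "cutoff k t \<le> fact k"
proof (cases "t > 0")
  case True
  have "(\<Sum>n\<in>{k}. (1 / t) ^ n /\<^sub>R fact n) \<le> exp (1 / t)"
    unfolding exp_def using True by (intro sum_le_suminf summable_exp_generic) auto
  then show ?thesis
    using True by (simp add: cutoff_def exp_minus field_simps)
qed (simp add: cutoff_def)

lemma cutoff_Suc: "t * cutoff (Suc k) t = cutoff k t"
  by (simp add: cutoff_def)

lemma has_real_derivative_cutoff: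
  "(cutoff k has_real_derivative cutoff (k + 2) t - real k * cutoff (k + 1) t) (at t)"
proof -
  consider "t > 0" | "t < 0" | "t = 0" by linarith
  then show ?thesis
  proof cases
    case 1
    have "((\<lambda>t. exp (- 1 / t) / t ^ k) has_real_derivative cutoff (k + 2) t - real k * cutoff (k + 1) t) (at t)"
    proof -
      have "((\<lambda>t. t ^ k) has_real_derivative real k * (t ^ k / t)) (at t)"
        using DERIV_power[OF DERIV_ident, of k t UNIV] 1 by (cases k) (auto simp: mult_ac)
      then show ?thesis
        using 1 by (auto intro!: derivative_eq_intros simp: cutoff_def field_simps power2_eq_square)
          (cases k; simp)
    qed
    then show ?thesis
      by (rule has_field_derivative_transform_within_open[where S="{0<..}"]) (use 1 in \<open>auto simp: cutoff_def\<close>)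
  next
    case 2
    have "((\<lambda>t. 0) has_real_derivative cutoff (k + 2) t - real k * cutoff (k + 1) t) (at t)"
      using 2 by (simp add: cutoff_def)
    then show ?thesis
      by (rule has_field_derivative_transform_within_open[where S="{..<0}"]) (use 2 in \<open>auto simp: cutoff_def\<close>)
  next
    case 3
    have "((\<lambda>h. cutoff k h / h) \<longlongrightarrow> 0) (at 0)"
    proof (rule Lim_null_comparison)
      have "norm (cutoff k h / h) \<le> fact (k + 2) * \<bar>h\<bar>" for h
      proof (cases "h = 0")
        case False
        \<comment> \<open>Of the two factors h split off, one cancels the denominator and one
          remains; with the factorial bound this makes the difference quotient at 0 of order
          h.\<close>
        have "cutoff k h / h = h * cutoff (k + 2) h"
        proof -
          have "cutoff k h = h * (h * cutoff (k + 2) h)"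
            by (simp add: cutoff_Suc)
          then show ?thesis
            using False by simp
        qed
        then show ?thesis
          using cutoff_nonneg[of "k+2" h] cutoff_le_fact[of "k+2" h] mult_right_mono[of "cutoff (k+2) h" "fact (k+2)" "\<bar>h\<bar>"]
          by (simp add: abs_mult mult_ac)
      qed simp
      then show "\<forall>\<^sub>F h in at 0. norm (cutoff k h / h) \<le> fact (k + 2) * \<bar>h\<bar>"
        by simp
      show "((\<lambda>h. fact (k + 2) * \<bar>h\<bar>) \<longlongrightarrow> (0::real)) (at 0)"
        by (intro tendsto_eq_intros) auto
    qed
    then show ?thesis
      using 3 by (simp add: DERIV_def cutoff_def)
  qed
qed

text \<open>The derivative of \<open>cutoff 0\<close> is \<open>cutoff 2\<close>, whose own
  derivative \<open>cutoff 4 - 2 * cutoff 3\<close> is bounded by 4! + 2 * 3! = 36. The remainder is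
  uniform in both points, as needed under an integral sign.\<close>

lemma cutoff_Taylor: "\<bar>cutoff 0 t - cutoff 0 s - cutoff 2 s * (t - s)\<bar> \<le> 36 * (t - s)\<^sup>2"
proof -
  have lip: "\<bar>cutoff 2 x - cutoff 2 s\<bar> \<le> 36 * \<bar>x - s\<bar>" for x s
  proof -
    have "norm (cutoff 2 x - cutoff 2 s) \<le> 36 * norm (x - s)"
    proof (rule field_differentiable_bound[where S=UNIV])
      show "(cutoff 2 has_field_derivative cutoff (2 + 2) z - real 2 * cutoff (2 + 1) z) (at z within UNIV)" for z
        using has_real_derivative_cutoff[of 2 z] by simp
      show "norm (cutoff (2 + 2) z - real 2 * cutoff (2 + 1) z) \<le> 36" for z
        using cutoff_nonneg[of 4 z] cutoff_le_fact[of 4 z] cutoff_nonneg[of 3 z] cutoff_le_fact[of 3 z]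
        by (simp add: fact_numeral)
    qed auto
    then show ?thesis by simp
  qed
  define g where "g x = cutoff 0 x - cutoff 2 s * x" for x
  have "norm (g t - g s) \<le> (36 * \<bar>t - s\<bar>) * norm (t - s)"
  proof (rule field_differentiable_bound[where S="closed_segment s t"])
    show "(g has_field_derivative cutoff 2 x - cutoff 2 s) (at x within closed_segment s t)" for x
      unfolding g_def using has_field_derivative_at_within[OF has_real_derivative_cutoff[of 0 x]]
      by (auto intro!: derivative_eq_intros simp: numeral_2_eq_2)
    show "norm (cutoff 2 x - cutoff 2 s) \<le> 36 * \<bar>t - s\<bar>" if "x \<in> closed_segment s t" for x
      using lip[of x s] that by (auto simp: closed_segment_eq_real_ivl split: if_splits)
  qed auto
  moreover have "(36 * \<bar>t - s\<bar>) * norm (t - s) = 36 * (t - s)\<^sup>2"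
    by (simp add: power2_eq_square flip: abs_mult)
  moreover have "g t - g s = cutoff 0 t - cutoff 0 s - cutoff 2 s * (t - s)"
    by (simp add: g_def algebra_simps)
  ultimately show ?thesis
    by simp
qed

text \<open>This algebra is closed under partial derivatives, so its elements are smooth.\<close>

inductive_set bump_algebra :: "real \<Rightarrow> complex \<Rightarrow> (complex \<Rightarrow> complex) set" for e w where
  const: "(\<lambda>_. c) \<in> bump_algebra e w"
| Re: "(\<lambda>z. complex_of_real (Re z)) \<in> bump_algebra e w"
| Im: "(\<lambda>z. complex_of_real (Im z)) \<in> bump_algebra e w"
| cutoff: "(\<lambda>z. complex_of_real (cutoff k (e\<^sup>2 - (norm (z - w))\<^sup>2))) \<in> bump_algebra e w"
| add: "f \<in> bump_algebra e w \<Longrightarrow> g \<in> bump_algebra e w \<Longrightarrow> (\<lambda>z. f z + g z) \<in> bump_algebra e w"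
| mult: "f \<in> bump_algebra e w \<Longrightarrow> g \<in> bump_algebra e w \<Longrightarrow> (\<lambda>z. f z * g z) \<in> bump_algebra e w"

lemma has_derivative_cutoff_norm:
  "((\<lambda>z. complex_of_real (cutoff k (e\<^sup>2 - (norm (z - w))\<^sup>2))) has_derivative
    (\<lambda>v. complex_of_real (Re v) * (- 2 * of_real (Re z - Re w) * of_real (cutoff (k+2) (e\<^sup>2 - (norm (z - w))\<^sup>2) - k * cutoff (k+1) (e\<^sup>2 - (norm (z - w))\<^sup>2)))
       + complex_of_real (Im v) * (- 2 * of_real (Im z - Im w) * of_real (cutoff (k+2) (e\<^sup>2 - (norm (z - w))\<^sup>2) - k * cutoff (k+1) (e\<^sup>2 - (norm (z - w))\<^sup>2))))) (at z)"
proof -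
  have nn: "(norm (z - w))\<^sup>2 = (Re z - Re w)\<^sup>2 + (Im z - Im w)\<^sup>2" for z
    by (simp add: cmod_power2)
  have 1: "((\<lambda>z. e\<^sup>2 - (norm (z - w))\<^sup>2) has_derivative
      (\<lambda>v. - 2 * (Re z - Re w) * Re v - 2 * (Im z - Im w) * Im v)) (at z)"
    unfolding nn by (auto intro!: derivative_eq_intros simp: algebra_simps fun_eq_iff)
  have 2: "(cutoff k has_derivative (*) (cutoff (k+2) (e\<^sup>2 - (norm (z - w))\<^sup>2) - k * cutoff (k+1) (e\<^sup>2 - (norm (z - w))\<^sup>2)))
      (at (e\<^sup>2 - (norm (z - w))\<^sup>2))"
    using has_real_derivative_cutoff by (simp add: has_field_derivative_def)
  show ?thesis
    by (rule has_derivative_eq_rhs[OF has_derivative_of_real[OF has_derivative_compose[OF 1 2]]])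
      (auto simp: fun_eq_iff algebra_simps)
qed

text \<open>The derivative is recorded by its values in the directions 1 and \<open>\<i>\<close>,
  the only ones that \<open>test_fun\<close> feeds to \<open>pderivs\<close>.\<close>

lemma bump_algebra_has_derivative:
  assumes "f \<in> bump_algebra e w"
  shows "\<exists>D1\<in>bump_algebra e w. \<exists>D2\<in>bump_algebra e w.
    \<forall>z. (f has_derivative (\<lambda>v. complex_of_real (Re v) * D1 z + complex_of_real (Im v) * D2 z)) (at z)"
  using assms
proof induction
  case (const c)
  show ?case
    by (intro bexI[of _ "\<lambda>_. 0"] bump_algebra.const) auto
next
  case Re
  show ?case
    by (intro bexI[of _ "\<lambda>_. 1"] bexI[of _ "\<lambda>_. 0"] bump_algebra.const)
      (auto intro!: derivative_eq_intros)
next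
  case Im
  show ?case
    by (intro bexI[of _ "\<lambda>_. 1"] bexI[of _ "\<lambda>_. 0"] bump_algebra.const)
      (auto intro!: derivative_eq_intros)
next
  case (cutoff k)
  have D: "(\<lambda>z. of_real (cutoff (k+2) (e\<^sup>2 - (norm (z - w))\<^sup>2)) + (- of_nat k) * of_real (cutoff (k+1) (e\<^sup>2 - (norm (z - w))\<^sup>2))) \<in> bump_algebra e w"
    by (intro bump_algebra.intros)
  have 1: "(\<lambda>z. (-2 * (of_real (Re z) + of_real (- Re w))) * (of_real (cutoff (k+2) (e\<^sup>2 - (norm (z - w))\<^sup>2)) + (- of_nat k) * of_real (cutoff (k+1) (e\<^sup>2 - (norm (z - w))\<^sup>2)))) \<in> bump_algebra e w"
    by (intro bump_algebra.mult[OF _ D] bump_algebra.intros)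
  have 2: "(\<lambda>z. (-2 * (of_real (Im z) + of_real (- Im w))) * (of_real (cutoff (k+2) (e\<^sup>2 - (norm (z - w))\<^sup>2)) + (- of_nat k) * of_real (cutoff (k+1) (e\<^sup>2 - (norm (z - w))\<^sup>2)))) \<in> bump_algebra e w"
    by (intro bump_algebra.mult[OF _ D] bump_algebra.intros)
  show ?case
    by (rule bexI[OF bexI[OF _ 2] 1]) (use has_derivative_cutoff_norm[of k e w] in simp)
next
  case (add f g)
  then obtain D1 D2 E1 E2 where D: "D1 \<in> bump_algebra e w" "D2 \<in> bump_algebra e w"
      "E1 \<in> bump_algebra e w" "E2 \<in> bump_algebra e w"
    and d: "\<And>z. (f has_derivative (\<lambda>v. complex_of_real (Re v) * D1 z + complex_of_real (Im v) * D2 z)) (at z)"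
      "\<And>z. (g has_derivative (\<lambda>v. complex_of_real (Re v) * E1 z + complex_of_real (Im v) * E2 z)) (at z)"
    by blast
  show ?case
    by (rule bexI[OF bexI[OF _ bump_algebra.add[OF D(2,4)]] bump_algebra.add[OF D(1,3)]])
      (auto intro!: derivative_eq_intros d simp: algebra_simps)
next
  case (mult f g)
  then obtain D1 D2 E1 E2 where D: "D1 \<in> bump_algebra e w" "D2 \<in> bump_algebra e w"
      "E1 \<in> bump_algebra e w" "E2 \<in> bump_algebra e w"
    and d: "\<And>z. (f has_derivative (\<lambda>v. complex_of_real (Re v) * D1 z + complex_of_real (Im v) * D2 z)) (at z)"
      "\<And>z. (g has_derivative (\<lambda>v. complex_of_real (Re v) * E1 z + complex_of_real (Im v) * E2 z)) (at z)"
    by blast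
  show ?case
    by (rule bexI[OF bexI[OF _ bump_algebra.add[OF bump_algebra.mult[OF mult(1) D(4)] bump_algebra.mult[OF D(2) mult(2)]]]
        bump_algebra.add[OF bump_algebra.mult[OF mult(1) D(3)] bump_algebra.mult[OF D(1) mult(2)]]])
      (auto intro!: derivative_eq_intros d simp: algebra_simps)
qed

lemma pderivs_bump_algebra:
  assumes "f \<in> bump_algebra e w" "vs \<in> lists {1, \<i>}"
  shows "pderivs vs f \<in> bump_algebra e w"
  using assms(2)
proof (induction vs)
  case (Cons v vs)
  then obtain D1 D2 where D: "D1 \<in> bump_algebra e w" "D2 \<in> bump_algebra e w"
    "\<And>z. (pderivs vs f has_derivative (\<lambda>v. complex_of_real (Re v) * D1 z + complex_of_real (Im v) * D2 z)) (at z)"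
    using bump_algebra_has_derivative[of "pderivs vs f" e w] by auto
  have "frechet_derivative (pderivs vs f) (at z) v = complex_of_real (Re v) * D1 z + complex_of_real (Im v) * D2 z" for z
    using frechet_derivative_at[OF D(3)[of z]] by metis
  then have "pderivs (v # vs) f = D1 \<or> pderivs (v # vs) f = D2"
    using Cons by (auto simp: fun_eq_iff)
  with D show ?case by metis
qed (use assms in simp)

lemma test_fun_bump: "test_fun (\<lambda>z. complex_of_real (cutoff k (e\<^sup>2 - (norm (z - w))\<^sup>2)))" (is "test_fun ?f")
proof -
  have f: "?f \<in> bump_algebra e w"
    by (rule bump_algebra.cutoff)
  have "norm (z - w) \<le> \<bar>e\<bar>" if "?f z \<noteq> 0" for z
  proof -
    have "(norm (z - w))\<^sup>2 \<le> \<bar>e\<bar>\<^sup>2"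
      using that by (auto simp: cutoff_def split: if_splits)
    then show ?thesis
      by (rule power2_le_imp_le) simp
  qed
  then have "{z. ?f z \<noteq> 0} \<subseteq> cball w \<bar>e\<bar>"
    by (auto simp: dist_norm norm_minus_commute)
  then have "compact (closure {z. ?f z \<noteq> 0})"
    by (metis bounded_cball bounded_subset compact_closure)
  moreover have "pderivs vs ?f differentiable (at z)" if "vs \<in> lists {1, \<i>}" for vs z
    using bump_algebra_has_derivative[OF pderivs_bump_algebra[OF f that]]
    by (auto simp: differentiable_def)
  ultimately show ?thesis
    by (simp add: test_fun_def)
qed

text \<open>The antiholomorphic derivative of the inner function is -(z - w), and
  \<open>cutoff 2\<close> is the derivative of \<open>cutoff 0\<close>. Testing with this function
  will remove the antilinear part of the derivative of a mollification.\<close>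

lemma dbar_bump:
  "dbar (\<lambda>z. complex_of_real (cutoff 0 (e\<^sup>2 - (norm (z - w))\<^sup>2))) z = - (z - w) * cutoff 2 (e\<^sup>2 - (norm (z - w))\<^sup>2)"
  unfolding dbar_def frechet_derivative_at[OF has_derivative_cutoff_norm[of 0 e w z], symmetric]
  by (simp add: complex_eq_iff numeral_2_eq_2 field_simps)

text \<open>The mass is not normalised to 1; it is carried along as a positive factor and divided
  out where needed.\<close>

definition bump :: "real \<Rightarrow> complex \<Rightarrow> real" where
  "bump e z = cutoff 0 (e\<^sup>2 - (norm z)\<^sup>2)"

lemma continuous_on_cutoff: "continuous_on S (cutoff k)"
  using has_real_derivative_cutoff by (auto intro!: continuous_at_imp_continuous_on DERIV_isCont)

lemma continuous_cutoff_norm: "continuous_on S (\<lambda>z::complex. cutoff k (e\<^sup>2 - (norm (z - w))\<^sup>2))"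
  by (intro continuous_on_compose2[OF continuous_on_cutoff[of UNIV]] continuous_intros) auto

lemma borel_measurable_bump [measurable]: "bump e \<in> borel_measurable borel"
  using continuous_cutoff_norm[of UNIV 0 e 0]
  by (intro borel_measurable_continuous_onI) (simp add: bump_def)

lemma bump_nonneg: "0 \<le> bump e z"
  by (simp add: bump_def cutoff_nonneg)

lemma bump_le_1: "bump e z \<le> 1"
  using cutoff_le_fact[of 0] by (simp add: bump_def)

lemma cutoff_norm_eq_0: "norm z \<ge> e \<Longrightarrow> e \<ge> 0 \<Longrightarrow> cutoff k (e\<^sup>2 - (norm z)\<^sup>2) = 0"
proof -
  assume "norm z \<ge> e" "e \<ge> 0"
  then have "\<not> e\<^sup>2 - (norm z)\<^sup>2 > 0"
    using power_mono[of e "norm z" 2] by linarith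
  then show ?thesis
    by (simp only: cutoff_def if_False)
qed

lemma bump_eq_0: "norm z \<ge> e \<Longrightarrow> e \<ge> 0 \<Longrightarrow> bump e z = 0"
  by (simp add: bump_def cutoff_norm_eq_0)

lemma integrable_lborel_bounded_support:
  fixes f :: "'a::euclidean_space \<Rightarrow> 'b::{banach, second_countable_topology}"
  assumes "f \<in> borel_measurable borel" "\<And>x. norm (f x) \<le> M" "\<And>x. norm x > r \<Longrightarrow> f x = 0"
  shows "integrable lborel f"
proof (rule integrableI_bounded_set[where A="cball 0 r" and B=M])
  show "emeasure lborel (cball (0::'a) r) < \<infinity>"
    by (rule emeasure_bounded_finite) simp
qed (use assms in auto)

lemma integrable_bump: "e \<ge> 0 \<Longrightarrow> integrable lborel (bump e)"
  by (rule integrable_lborel_bounded_support[where M=1 and r=e])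
    (auto simp: bump_nonneg bump_le_1 bump_eq_0)

lemma integral_bump_pos:
  assumes "e > 0"
  shows "(\<integral>z. bump e z \<partial>lborel) > 0"
proof -
  have "(\<integral>z. bump e z \<partial>lborel) \<noteq> 0"
  proof
    assume "(\<integral>z. bump e z \<partial>lborel) = 0"
    then have "AE z in lborel. bump e z = 0"
      using assms by (subst (asm) integral_nonneg_eq_0_iff_AE) (auto simp: integrable_bump bump_nonneg)
    then have "AE z in lborel. \<not> z \<in> ball (0::complex) e"
    proof eventually_elim
      case (elim z)
      then show ?case
        using power_strict_mono[of "norm z" e 2] by (auto simp: bump_def cutoff_def)
    qed
    then have "emeasure lborel (ball (0::complex) e) = 0"
      by (subst (asm) AE_iff_measurable[OF _ refl]) (auto simp: ball_def)
    with assms show False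
      using content_ball_pos[of e "0::complex"] by (simp add: measure_def)
  qed
  then show ?thesis
    using Bochner_Integration.integral_nonneg[of lborel "bump e"] bump_nonneg by (simp add: order_less_le)
qed

lemma integral_lborel_reflect:
  fixes f :: "complex \<Rightarrow> 'b::{banach, second_countable_topology}"
  assumes [measurable]: "f \<in> borel_measurable borel"
  shows "(\<integral>z. f (c - z) \<partial>lborel) = (\<integral>z. f z \<partial>lborel)"
  using integral_lborel_rotate[of "\<lambda>z. f (c + z)" "-1"] integral_lborel_translate[of f c] by simp

lemma integral_bump_shift: "(\<integral>z. bump e (c - z) \<partial>lborel) = (\<integral>z. bump e z \<partial>lborel)"
  by (rule integral_lborel_reflect) simp

text \<open>Moving w to the origin leaves a radial weight of bounded support, and the coefficient
  formula with n = 0 picks out the constant Taylor coefficient H w.\<close>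

lemma mean_value_bump:
  assumes H: "H holomorphic_on UNIV" and e: "e \<ge> 0"
  shows "(\<integral>z. H z * bump e (z - w) \<partial>lborel) = H w * (\<integral>z. bump e z \<partial>lborel)"
proof -
  have [measurable]: "H \<in> borel_measurable borel"
    using H by (intro borel_measurable_continuous_onI holomorphic_on_imp_continuous_on)
  define a where "a k = (deriv ^^ k) H w / fact k" for k
  have a: "(\<lambda>k. a k * z ^ k) sums H (w + z)" for z
    using holomorphic_power_series[of H w "norm z + 1" "w + z"] H holomorphic_on_subset
    by (auto simp: a_def dist_norm)
  have "(\<integral>z. H z * bump e (z - w) \<partial>lborel) = (\<integral>z. H (w + z) * bump e (w + z - w) \<partial>lborel)"
    by (rule integral_lborel_translate[symmetric]) measurable
  also have "\<dots> = (\<integral>z. H (w + z) * cnj z ^ 0 * bump e z \<partial>lborel)"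
    by simp
  also have "\<dots> = a 0 * (\<integral>z. norm z ^ (2 * 0) * bump e z \<partial>lborel)"
    by (rule integral_powser_radial_bounded[OF a, where r=e])
      (use e in \<open>auto simp: bump_def norm_mult integrable_bump[unfolded bump_def] cutoff_norm_eq_0\<close>)
  finally show ?thesis
    by (simp add: a_def)
qed

section \<open>Weyl's lemma for the Cauchy-Riemann operator\<close>

text \<open>Borel measurability of \<open>h\<close> makes the two-variable integrands in Fubini's
  theorem measurable for the product measure. Elements of the weighted space are replaced by such
  representatives in \<open>L2w_locally_integrable\<close>.\<close>

locale locally_integrable =
  fixes h :: "complex \<Rightarrow> complex"
  assumes borel_measurable_h [measurable]: "h \<in> borel_measurable borel"
    and locally: "\<And>r. integrable lborel (\<lambda>z. indicator (cball 0 r) z *\<^sub>R h z)"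
begin

lemma integrable_mult_bounded_support:
  assumes [measurable]: "\<phi> \<in> borel_measurable borel"
    and "\<And>z. norm (\<phi> z) \<le> M" "\<And>z. norm z > r \<Longrightarrow> \<phi> z = 0"
  shows "integrable lborel (\<lambda>z. h z * \<phi> z :: complex)"
proof (rule Bochner_Integration.integrable_bound)
  show "integrable lborel (\<lambda>z. M * norm (indicator (cball 0 r) z *\<^sub>R h z))"
    using locally[of r, THEN integrable_norm] by (intro integrable_mult_right) simp
  show "AE z in lborel. norm (h z * \<phi> z) \<le> norm (M * norm (indicator (cball 0 r) z *\<^sub>R h z))"
  proof (rule AE_I2)
    fix z
    show "norm (h z * \<phi> z) \<le> norm (M * norm (indicator (cball 0 r) z *\<^sub>R h z))"
    proof (cases "norm z > r")
      case False
      have "norm (h z) * norm (\<phi> z) \<le> norm (h z) * M"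
        using assms(2) by (intro mult_left_mono) auto
      also have "\<dots> \<le> norm (h z) * \<bar>M\<bar>"
        by (intro mult_left_mono) auto
      finally show ?thesis
        using False by (simp add: norm_mult abs_mult mult_ac)
    qed (use assms in auto)
  qed
qed auto

definition mollify :: "real \<Rightarrow> complex \<Rightarrow> complex" where
  "mollify e w = (\<integral>z. h z * bump e (z - w) \<partial>lborel)"

lemma integrable_mollify:
  assumes "e \<ge> 0"
  shows "integrable lborel (\<lambda>z. h z * bump e (z - w))"
proof (rule integrable_mult_bounded_support[where M=1 and r="norm w + e"])
  show "complex_of_real (bump e (z - w)) = 0" if "norm w + e < norm z" for z
    using norm_triangle_ineq2[of z w] that assms by (auto intro!: bump_eq_0)
qed (auto simp: bump_nonneg bump_le_1)

text \<open>The bounded supports of \<open>\<psi>\<close> and of the kernel confine z to the ball of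
  radius r + e, so the integrand is dominated by a product of an integrable function of x and one of
  z.\<close>

lemma Fubini_mollify:
  fixes \<psi> :: "complex \<Rightarrow> real"
  assumes [measurable]: "\<psi> \<in> borel_measurable borel"
    and bd: "\<And>x. norm (\<psi> x) \<le> M" "\<And>x. norm x > r \<Longrightarrow> \<psi> x = 0" and e: "e \<ge> 0"
  shows "(\<integral>x. \<psi> x * mollify e x \<partial>lborel) = (\<integral>z. h z * (\<integral>x. bump e (z - x) * \<psi> x \<partial>lborel) \<partial>lborel)"
proof -
  define F where "F x z = \<psi> x * (h z * bump e (z - x))" for x z
  define I where "I z = indicator (cball 0 (r + e)) z *\<^sub>R h z" for z
  have [measurable]: "I \<in> borel_measurable borel"
    using borel_measurable_integrable[OF locally] by (simp add: I_def[abs_def])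
  have int\<psi>: "integrable lborel \<psi>"
    using assms by (intro integrable_lborel_bounded_support)
  have intI: "integrable lborel I"
    unfolding I_def by (rule locally)
  have "integrable (lborel \<Otimes>\<^sub>M lborel) (\<lambda>p. \<psi> (fst p) * I (snd p))"
  proof (rule lborel_pair.Fubini_integrable)
    show "integrable lborel (\<lambda>x. \<integral>y. norm (\<psi> (fst (x, y)) * I (snd (x, y))) \<partial>lborel)"
      using int\<psi> by (simp add: norm_mult)
    show "AE x in lborel. integrable lborel (\<lambda>y. \<psi> (fst (x, y)) * I (snd (x, y)))"
      using intI by simp
  qed measurable
  then have int: "integrable (lborel \<Otimes>\<^sub>M lborel) (\<lambda>p. F (fst p) (snd p))"
  proof (rule Bochner_Integration.integrable_bound)
    show "(\<lambda>p. F (fst p) (snd p)) \<in> borel_measurable (lborel \<Otimes>\<^sub>M lborel)"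
      unfolding F_def by measurable
    have "norm (F x z) \<le> norm (\<psi> x * I z)" for x z
    proof (cases "norm x > r \<or> norm (z - x) \<ge> e")
      case True
      then show ?thesis
        using bd e by (auto simp: F_def bump_eq_0)
    next
      case False
      then have "norm z \<le> r + e"
        using norm_triangle_ineq2[of z x] by auto
      then have "I z = h z" by (simp add: I_def)
      moreover have "norm (h z) * norm (bump e (z - x)) \<le> norm (h z) * 1"
        using bump_nonneg bump_le_1 by (intro mult_left_mono) auto
      ultimately show ?thesis
        by (simp add: F_def norm_mult mult_left_mono)
    qed
    then show "AE p in lborel \<Otimes>\<^sub>M lborel. norm (F (fst p) (snd p)) \<le> norm (\<psi> (fst p) * I (snd p))"
      by simp
  qed
  have "(\<integral>x. \<psi> x * mollify e x \<partial>lborel) = (\<integral>x. (\<integral>z. F x z \<partial>lborel) \<partial>lborel)"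
    by (simp add: F_def mollify_def)
  also have "\<dots> = (\<integral>z. (\<integral>x. F x z \<partial>lborel) \<partial>lborel)"
    using lborel_pair.Fubini_integral[of F] int by (simp add: case_prod_beta')
  also have "\<dots> = (\<integral>z. h z * (\<integral>x. bump e (z - x) * \<psi> x \<partial>lborel) \<partial>lborel)"
    unfolding F_def by (intro Bochner_Integration.integral_cong refl)
      (simp add: mult_ac flip: integral_mult_right_zero integral_complex_of_real)
  finally show ?thesis .
qed

text \<open>By Fubini both sides pair \<open>h\<close> with a convolution of two bumps, and the
  reflection x to z + w - x exchanges the two factors of that convolution.\<close>

lemma mollify_commute:
  assumes "e \<ge> 0" "d \<ge> 0"
  shows "(\<integral>x. bump d (x - w) * mollify e x \<partial>lborel) = (\<integral>x. bump e (x - w) * mollify d x \<partial>lborel)"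
proof -
  have F: "(\<integral>x. bump d (x - w) * mollify e x \<partial>lborel)
      = (\<integral>z. h z * (\<integral>x. bump e (z - x) * bump d (x - w) \<partial>lborel) \<partial>lborel)" if "e \<ge> 0" "d \<ge> 0" for d e
  proof (rule Fubini_mollify[where M=1 and r="norm w + d"])
    show "bump d (x - w) = 0" if "norm w + d < norm x" for x
      using norm_triangle_ineq2[of x w] that \<open>d \<ge> 0\<close> by (auto intro!: bump_eq_0)
  qed (use that in \<open>auto simp: bump_nonneg bump_le_1\<close>)
  have "(\<integral>x. bump e (z - x) * bump d (x - w) \<partial>lborel) = (\<integral>x. bump d (z - x) * bump e (x - w) \<partial>lborel)" for z
    using integral_lborel_reflect[of "\<lambda>x. bump e (z - x) * bump d (x - w)" "z + w"]
    by (simp add: mult.commute)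
  then show ?thesis
    using assms by (simp add: F)
qed

end

locale weakly_holomorphic = locally_integrable +
  assumes weak: "\<And>\<phi>. test_fun \<phi> \<Longrightarrow> (\<integral>z. h z * dbar \<phi> z \<partial>lborel) = 0"
begin

text \<open>Differentiating the kernel in its centre gives a real-linear expression in the increment
  v. Its part proportional to cnj v is the integral of \<open>h\<close> against \<open>dbar\<close>
  of a bump, which vanishes, so the complex-linear part alone remains.\<close>

lemma mollify_holomorphic:
  assumes e: "e \<ge> 0"
  shows "mollify e holomorphic_on UNIV"
proof -
  have "\<exists>D. (mollify e has_field_derivative D) (at w)" for w
  proof -
    define b2 where "b2 z = cutoff 2 (e\<^sup>2 - (norm (z - w))\<^sup>2)" for z
    have [measurable]: "b2 \<in> borel_measurable borel"
      unfolding b2_def by (intro borel_measurable_continuous_onI continuous_cutoff_norm)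
    have b2: "0 \<le> b2 z" "b2 z \<le> 2" for z
      using cutoff_nonneg[of 2] cutoff_le_fact[of 2] by (auto simp: b2_def)
    have b20: "b2 z = 0" if "norm (z - w) \<ge> e" for z
      using that e by (simp add: b2_def cutoff_norm_eq_0)
    have far: "norm (z - w) \<ge> e" if "norm z > norm w + e" for z
      using norm_triangle_ineq2[of z w] that by linarith
    have int1: "integrable lborel (\<lambda>z. h z * (b2 z * (z - w)))"
    proof (rule integrable_mult_bounded_support[where M="2 * e" and r="norm w + e"])
      show "norm (b2 z * (z - w)) \<le> 2 * e" for z
        using b2[of z] b20[of z] e by (cases "norm (z - w) \<ge> e") (auto simp: norm_mult intro!: mult_mono)
    qed (use far b20 in auto)
    have int2: "integrable lborel (\<lambda>z. h z * (b2 z * cnj (z - w)))"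
    proof (rule integrable_mult_bounded_support[where M="2 * e" and r="norm w + e"])
      show "norm (b2 z * cnj (z - w)) \<le> 2 * e" for z
        using b2[of z] b20[of z] e by (cases "norm (z - w) \<ge> e") (auto simp: norm_mult simp del: complex_cnj_diff intro!: mult_mono)
    qed (use far b20 in auto)
    have zero: "(\<integral>z. h z * (b2 z * (z - w)) \<partial>lborel) = 0"
    proof -
      have "(\<integral>z. - (h z * (b2 z * (z - w))) \<partial>lborel) = 0"
        using weak[OF test_fun_bump[of 0 e w]] unfolding dbar_bump by (simp add: b2_def algebra_simps)
      then show ?thesis
        by simp
    qed
    define D where "D = (\<integral>z. h z * (b2 z * cnj (z - w)) \<partial>lborel)"
    \<comment> \<open>36 is the constant of \<open>cutoff_Taylor\<close>, (2 * e + 3) bounds the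
      change of the cutoff argument per unit of norm v, and 2 bounds \<open>b2\<close>.\<close>
    define C where "C = 36 * (2 * e + 3)\<^sup>2 + 2"
    \<comment> \<open>For norm v \<le> 1 this ball contains the supports of all the translated
      bumps.\<close>
    define r where "r = norm w + e + 1"
    have est: "norm (mollify e (w + v) - mollify e w - D * v) \<le> C * (norm v)\<^sup>2 * (\<integral>z. norm (indicator (cball 0 r) z *\<^sub>R h z) \<partial>lborel)"
      if v: "norm v \<le> 1" for v
    proof -
      define R where "R z = bump e (z - (w + v)) - bump e (z - w) - b2 z * (2 * Re ((z - w) * cnj v))" for z
      have R: "\<bar>R z\<bar> \<le> C * (norm v)\<^sup>2 * indicator (cball 0 r) z" for z
      proof (cases "norm (z - w) > e + 1")
        case True
        then have "norm (z - (w + v)) \<ge> e"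
          using norm_triangle_ineq2[of "z - w" v] v by (simp add: diff_diff_eq)
        then have "R z = 0"
          using True e b20[of z] by (simp add: R_def bump_eq_0)
        then show ?thesis
          by (simp add: C_def)
      next
        case False
        \<comment> \<open>These are the cutoff arguments for the centres w and w + v. Their
          difference is the linear term of \<open>R\<close> minus the square of norm v, so
          \<open>R\<close> is the Taylor remainder minus \<open>b2\<close> times that
          square.\<close>
        define s t where "s = e\<^sup>2 - (norm (z - w))\<^sup>2" and "t = e\<^sup>2 - (norm (z - (w + v)))\<^sup>2"
        have ts: "t - s = 2 * Re ((z - w) * cnj v) - (norm v)\<^sup>2"
          by (simp add: s_def t_def cmod_power2) (simp add: power2_eq_square algebra_simps)
        have "\<bar>t - s\<bar> \<le> 2 * norm ((z - w) * cnj v) + norm v * norm v"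
          unfolding ts power2_eq_square
          using abs_Re_le_cmod[of "(z - w) * cnj v"] zero_le_square[of "norm v"] by linarith
        also have "\<dots> \<le> 2 * ((e + 1) * norm v) + 1 * norm v"
          unfolding norm_mult complex_mod_cnj
          using False v by (intro add_mono mult_left_mono mult_right_mono) auto
        finally have "\<bar>t - s\<bar> \<le> (2 * e + 3) * norm v"
          by (simp add: algebra_simps)
        then have ts2: "(t - s)\<^sup>2 \<le> ((2 * e + 3) * norm v)\<^sup>2"
          by (metis abs_ge_zero power2_abs power_mono)
        have "R z = (cutoff 0 t - cutoff 0 s - cutoff 2 s * (t - s)) - b2 z * (norm v)\<^sup>2"
          by (simp add: R_def bump_def b2_def ts flip: s_def t_def) (simp add: algebra_simps)
        then have "\<bar>R z\<bar> \<le> 36 * (t - s)\<^sup>2 + b2 z * (norm v)\<^sup>2"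
          using cutoff_Taylor[of t s] mult_nonneg_nonneg[OF b2(1)[of z] zero_le_power2[of "norm v"]] by linarith
        also have "\<dots> \<le> 36 * ((2 * e + 3) * norm v)\<^sup>2 + 2 * (norm v)\<^sup>2"
          using ts2 b2[of z] by (intro add_mono mult_mono) auto
        also have "\<dots> = C * (norm v)\<^sup>2"
          unfolding C_def power_mult_distrib by (simp only: distrib_right[of _ _ "_\<^sup>2"] mult.assoc)
        finally have "\<bar>R z\<bar> \<le> C * (norm v)\<^sup>2" .
        moreover have "norm z \<le> r"
          using norm_triangle_ineq2[of z w] False by (simp add: r_def)
        ultimately show ?thesis
          by simp
      qed
      have Rint: "integrable lborel (\<lambda>z. h z * R z)"
      proof (rule integrable_mult_bounded_support[where M="C * (norm v)\<^sup>2" and r=r])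
        show "(\<lambda>z. complex_of_real (R z)) \<in> borel_measurable borel"
          unfolding R_def by measurable
        show "norm (complex_of_real (R z)) \<le> C * (norm v)\<^sup>2" for z
          using R[of z] by (auto simp: C_def split: split_indicator_asm intro: order_trans)
        show "complex_of_real (R z) = 0" if "norm z > r" for z
          using R[of z] that by simp
      qed
      \<comment> \<open>Twice the real part is split into a multiple of cnj v, whose integral is
        \<open>zero\<close>, and a multiple of v, which yields \<open>D\<close>.\<close>
      have eq: "h z * bump e (z - (w + v)) - h z * bump e (z - w) - (h z * (b2 z * cnj (z - w))) * v
          = h z * R z + (h z * (b2 z * (z - w))) * cnj v" for z
      proof -
        have gen: "a * p - a * q - (a * (b * y)) * u = a * (p - q - b * (x * u' + y * u)) + (a * (b * x)) * u'"
          for a b p q x y u u' :: complex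
          by (simp add: algebra_simps)
        have "complex_of_real (2 * Re ((z - w) * cnj v)) = (z - w) * cnj v + cnj (z - w) * v"
          by (simp add: complex_eq_iff algebra_simps)
        then show ?thesis
          by (simp only: R_def of_real_diff of_real_mult[of "b2 z"] gen)
      qed
      have "mollify e (w + v) - mollify e w - D * v
          = (\<integral>z. h z * bump e (z - (w + v)) - h z * bump e (z - w) - (h z * (b2 z * cnj (z - w))) * v \<partial>lborel)"
        unfolding mollify_def D_def
        using integrable_mollify[OF e] int2 by (simp add: integral_diff integral_mult_left)
      also have "\<dots> = (\<integral>z. h z * R z \<partial>lborel) + (\<integral>z. h z * (b2 z * (z - w)) \<partial>lborel) * cnj v"
        unfolding eq using Rint int1 by (simp add: integral_add integral_mult_left)
      finally have "norm (mollify e (w + v) - mollify e w - D * v) = norm (\<integral>z. h z * R z \<partial>lborel)"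
        by (simp add: zero)
      also have "\<dots> \<le> (\<integral>z. norm (h z * R z) \<partial>lborel)"
        by (rule integral_norm_bound)
      also have "\<dots> \<le> (\<integral>z. C * (norm v)\<^sup>2 * norm (indicator (cball 0 r) z *\<^sub>R h z) \<partial>lborel)"
      proof (rule integral_mono)
        show "norm (h z * R z) \<le> C * (norm v)\<^sup>2 * norm (indicator (cball 0 r) z *\<^sub>R h z)" for z
          using mult_left_mono[OF R[of z], of "norm (h z)"] by (simp add: norm_mult mult_ac)
      qed (use Rint locally[of r, THEN integrable_norm] in \<open>auto intro!: integrable_mult_right simp del: norm_scaleR\<close>)
      finally show ?thesis
        by simp
    qed
    define K where "K = C * (\<integral>z. norm (indicator (cball 0 r) z *\<^sub>R h z) \<partial>lborel)"
    have "((\<lambda>v. (mollify e (w + v) - mollify e w) / v - D) \<longlongrightarrow> 0) (at 0)"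
    proof (rule Lim_null_comparison)
      have "norm ((mollify e (w + v) - mollify e w) / v - D) \<le> K * norm v" if "norm v \<le> 1" "v \<noteq> 0" for v
      proof -
        have "norm ((mollify e (w + v) - mollify e w) / v - D) = norm (mollify e (w + v) - mollify e w - D * v) / norm v"
          using that by (simp add: field_simps flip: norm_divide)
        also have "\<dots> \<le> (K * (norm v)\<^sup>2) / norm v"
          using est[OF that(1)] by (intro divide_right_mono) (auto simp: K_def mult_ac)
        finally show ?thesis
          using that by (simp add: power2_eq_square)
      qed
      then show "\<forall>\<^sub>F v in at 0. norm ((mollify e (w + v) - mollify e w) / v - D) \<le> K * norm v"
        by (auto simp: eventually_at intro!: exI[of _ 1])
      show "((\<lambda>v::complex. K * norm v) \<longlongrightarrow> 0) (at 0)"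
        by (intro tendsto_eq_intros) auto
    qed
    then have "(mollify e has_field_derivative D) (at w)"
      unfolding DERIV_def by (simp flip: Lim_null)
    then show ?thesis ..
  qed
  then show ?thesis
    by (auto simp: holomorphic_on_def field_differentiable_def)
qed

text \<open>Mollifying a holomorphic function by a radial kernel only multiplies it by the mass of the
  kernel, and mollifications commute, so the normalised mollification is independent of the scale.\<close>

lemma mollify_eq:
  assumes "e \<ge> 0" "d \<ge> 0"
  shows "mollify e w * (\<integral>z. bump d z \<partial>lborel) = mollify d w * (\<integral>z. bump e z \<partial>lborel)"
  using mean_value_bump[OF mollify_holomorphic[OF assms(1)] assms(2), of w]
    mean_value_bump[OF mollify_holomorphic[OF assms(2)] assms(1), of w] mollify_commute[OF assms, of w]
  by (simp add: mult.commute)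

text \<open>This is the common value of all normalised mollifications of positive scale; the scale 1
  is just a representative.\<close>

definition regular :: "complex \<Rightarrow> complex" where
  "regular w = mollify 1 w / (\<integral>z. bump 1 z \<partial>lborel)"

lemma regular_holomorphic: "regular holomorphic_on UNIV"
  unfolding regular_def using mollify_holomorphic[of 1] integral_bump_pos[of 1]
  by (intro holomorphic_intros) auto

lemma mollify_eq_regular: "e \<ge> 0 \<Longrightarrow> mollify e w = regular w * (\<integral>z. bump e z \<partial>lborel)"
  using mollify_eq[of e 1 w] integral_bump_pos[of 1] by (simp add: regular_def field_simps)

text \<open>Fubini moves the mollifier from \<open>h\<close> onto the indicator of the box. The
  mollified \<open>h\<close> is \<open>regular\<close> at every scale, so the resulting integrals do
  not depend on the scale, while the smoothed indicators converge to the indicator off the boundary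
  of the box.\<close>

lemma integral_cbox_regular:
  "(\<integral>z. indicator (cbox a b) z *\<^sub>R h z \<partial>lborel) = (\<integral>z. indicator (cbox a b) z *\<^sub>R regular z \<partial>lborel)"
proof -
  obtain r where r: "cbox a b \<subseteq> cball 0 r"
    using bounded_subset_ballD[OF bounded_cbox] ball_subset_cball by (metis subset_trans)
  define \<psi> :: "complex \<Rightarrow> real" where "\<psi> = indicator (cbox a b)"
  have [measurable]: "\<psi> \<in> borel_measurable borel"
    by (simp add: \<psi>_def)
  have \<psi>: "0 \<le> \<psi> z" "\<psi> z \<le> 1" for z
    by (auto simp: \<psi>_def split: split_indicator)
  define e where "e n = 1 / real (Suc n)" for n
  have e: "e n > 0" "e n \<le> 1" for n
    by (auto simp: e_def)
  have e_lim: "e \<longlonglongrightarrow> 0"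
    using LIMSEQ_inverse_real_of_nat by (simp add: e_def[abs_def] inverse_eq_divide)
  define K where "K n = (\<integral>z. bump (e n) z \<partial>lborel)" for n
  have K: "K n > 0" for n
    by (simp add: K_def e integral_bump_pos)
  define \<kappa> where "\<kappa> n z = (\<integral>x. bump (e n) (z - x) * \<psi> x \<partial>lborel) / K n" for n z
  have [measurable]: "\<kappa> n \<in> borel_measurable borel" for n
    unfolding \<kappa>_def by measurable
  have bump_int: "integrable lborel (\<lambda>x. bump (e n) (z - x))" for n z
  proof (rule integrable_lborel_bounded_support[where M=1 and r="norm z + e n"])
    show "bump (e n) (z - x) = 0" if "norm z + e n < norm x" for x
      using that e[of n] norm_triangle_ineq2[of x z] by (intro bump_eq_0) (auto simp: norm_minus_commute)
  qed (auto simp: bump_nonneg bump_le_1)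
  have conv_int: "integrable lborel (\<lambda>x. bump (e n) (z - x) * \<psi> x)" for n z
    by (rule Bochner_Integration.integrable_bound[OF bump_int[of n z]])
      (use \<psi> bump_nonneg in \<open>auto simp: mult_left_le\<close>)
  have \<kappa>: "0 \<le> \<kappa> n z" "\<kappa> n z \<le> 1" for n z
  proof -
    show "0 \<le> \<kappa> n z"
      using K[of n] \<psi> bump_nonneg by (auto simp: \<kappa>_def intro!: divide_nonneg_nonneg integral_nonneg)
    have "(\<integral>x. bump (e n) (z - x) * \<psi> x \<partial>lborel) \<le> (\<integral>x. bump (e n) (z - x) \<partial>lborel)"
      using \<psi> bump_nonneg by (intro integral_mono conv_int bump_int) (auto simp: mult_left_le)
    then show "\<kappa> n z \<le> 1"
      using K[of n] by (simp add: \<kappa>_def K_def integral_bump_shift)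
  qed
  have \<kappa>_supp: "\<kappa> n z = 0" if "\<And>x. x \<in> cbox a b \<Longrightarrow> norm (z - x) \<ge> e n" for n z
  proof -
    have "bump (e n) (z - x) * \<psi> x = 0" for x
      using that[of x] e[of n] by (auto simp: \<psi>_def bump_eq_0 split: split_indicator)
    then show ?thesis
      by (simp only: \<kappa>_def) simp
  qed
  have \<kappa>_far: "\<kappa> n z = 0" if "norm z > r + 1" for n z
  proof (rule \<kappa>_supp)
    fix x assume "x \<in> cbox a b"
    with r have "norm x \<le> r" by auto
    then show "norm (z - x) \<ge> e n"
      using norm_triangle_ineq2[of z x] that e[of n] by linarith
  qed
  have "(\<integral>z. \<psi> z * regular z \<partial>lborel) = (\<integral>z. h z * \<kappa> n z \<partial>lborel)" for n
  proof -
    have "(\<integral>x. \<psi> x * mollify (e n) x \<partial>lborel) = (\<integral>z. h z * (\<integral>x. bump (e n) (z - x) * \<psi> x \<partial>lborel) \<partial>lborel)"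
      using e[of n] r by (intro Fubini_mollify[where M=1 and r=r])
        (auto simp: \<psi>_def split: split_indicator)
    also have "\<dots> = (\<integral>z. h z * \<kappa> n z * K n \<partial>lborel)"
      using K[of n] by (simp add: \<kappa>_def)
    finally have "(\<integral>x. \<psi> x * regular x * K n \<partial>lborel) = (\<integral>z. h z * \<kappa> n z * K n \<partial>lborel)"
      using e[of n] by (simp add: mollify_eq_regular K_def mult.assoc)
    then show ?thesis
      using K[of n] by simp
  qed
  then have const: "(\<lambda>n. \<integral>z. h z * \<kappa> n z \<partial>lborel) = (\<lambda>_. \<integral>z. \<psi> z * regular z \<partial>lborel)"
    by simp
  have "(\<lambda>n. \<integral>z. h z * \<kappa> n z \<partial>lborel) \<longlonglongrightarrow> (\<integral>z. h z * \<psi> z \<partial>lborel)"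
  proof (rule integral_dominated_convergence[where w="\<lambda>z. norm (indicator (cball 0 (r + 1)) z *\<^sub>R h z)"])
    show "integrable lborel (\<lambda>z. norm (indicator (cball 0 (r + 1)) z *\<^sub>R h z))"
      by (intro integrable_norm locally)
    have "norm (h z * \<kappa> n z) \<le> norm (indicator (cball 0 (r + 1)) z *\<^sub>R h z)" for n z
      using \<kappa>[of n z] \<kappa>_far[of z n] by (auto simp: norm_mult mult_left_le split: split_indicator)
    then show "AE z in lborel. norm (h z * \<kappa> n z) \<le> norm (indicator (cball 0 (r + 1)) z *\<^sub>R h z)" for n
      by simp
    have "negligible (cbox a b - box a b)"
      by (rule negligible_frontier_interval)
    then have "AE z in lebesgue. z \<notin> cbox a b - box a b"
      unfolding negligible_iff_null_sets by (rule AE_not_in)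
    then have "AE z in lborel. z \<notin> cbox a b - box a b"
      by (simp add: AE_completion_iff)
    then show "AE z in lborel. (\<lambda>n. h z * \<kappa> n z) \<longlonglongrightarrow> h z * \<psi> z"
    proof eventually_elim
      case (elim z)
      \<comment> \<open>Off the boundary, small kernels around z see only the inside or only the
        outside of the box, so the smoothed indicator is eventually exact.\<close>
      have "\<forall>\<^sub>F n in sequentially. \<kappa> n z = \<psi> z"
      proof (cases "z \<in> cbox a b")
        case True
        then have "z \<in> box a b" using elim by auto
        then obtain \<delta> where \<delta>: "\<delta> > 0" "ball z \<delta> \<subseteq> cbox a b"
          using open_box[of a b] box_subset_cbox[of a b] by (meson open_contains_ball subset_trans)
        have "\<forall>\<^sub>F n in sequentially. e n < \<delta>"
          using \<delta>(1) by (rule order_tendstoD(2)[OF e_lim])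
        then show ?thesis
        proof eventually_elim
          case (elim n)
          have "bump (e n) (z - x) * \<psi> x = bump (e n) (z - x)" for x
          proof (cases "norm (z - x) \<ge> e n")
            case False
            then have "x \<in> ball z \<delta>" using elim by (simp add: dist_norm)
            then show ?thesis using \<delta> by (auto simp: \<psi>_def)
          qed (use e[of n] in \<open>simp add: bump_eq_0\<close>)
          then have "\<kappa> n z = 1"
            using K[of n] by (simp only: \<kappa>_def integral_bump_shift flip: K_def) simp
          then show ?case
            using True by (simp add: \<psi>_def)
        qed
      next
        case False
        then obtain \<delta> where \<delta>: "\<delta> > 0" "ball z \<delta> \<subseteq> - cbox a b"
          using closed_cbox[of a b] by (meson ComplI open_Compl open_contains_ball)
        have "\<forall>\<^sub>F n in sequentially. e n < \<delta>"
          using \<delta>(1) by (rule order_tendstoD(2)[OF e_lim])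
        then show ?thesis
        proof eventually_elim
          case (elim n)
          have "\<kappa> n z = 0"
          proof (rule \<kappa>_supp)
            fix x assume "x \<in> cbox a b"
            then have "x \<notin> ball z \<delta>" using \<delta> by auto
            then show "e n \<le> norm (z - x)" using elim by (simp add: dist_norm)
          qed
          then show ?case
            using False by (simp add: \<psi>_def)
        qed
      qed
      then show ?case
        by (intro tendsto_eventually) (auto elim: eventually_mono)
    qed
  qed (simp_all add: \<psi>_def)
  then have "(\<integral>z. h z * \<psi> z \<partial>lborel) = (\<integral>z. \<psi> z * regular z \<partial>lborel)"
    unfolding const by (rule LIMSEQ_unique) (rule tendsto_const)
  then show ?thesis
    by (simp add: \<psi>_def scaleR_conv_of_real mult.commute)
qed

text \<open>All box integrals of \<open>h - regular\<close> vanish, hence so do its averages over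
  small squares with corner x. Lebesgue differentiation makes the difference zero off a negligible
  set.\<close>

theorem AE_eq_regular: "AE z in lborel. h z = regular z"
proof -
  define g where "g z = h z - regular z" for z
  have cont: "continuous_on UNIV regular"
    by (intro holomorphic_on_imp_continuous_on regular_holomorphic)
  then have [measurable]: "regular \<in> borel_measurable borel"
    by (rule borel_measurable_continuous_onI)
  have set_h: "set_integrable lborel (cbox a b) h" for a b
  proof -
    obtain r where r: "cbox a b \<subseteq> cball 0 r"
      using bounded_subset_ballD[OF bounded_cbox] ball_subset_cball by (metis subset_trans)
    have "set_integrable lborel (cball 0 r) h"
      using locally by (simp add: set_integrable_def)
    then show ?thesis
      by (rule set_integrable_subset) (use r in auto)
  qed
  have set_r: "set_integrable lborel (cbox a b) regular" for a b
    using borel_integrable_compact[OF compact_cbox continuous_on_subset[OF cont]] by (simp add: set_integrable_def)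
  have set_g: "set_integrable lborel (cbox a b) g" for a b
    unfolding g_def by (intro set_integral_diff set_h set_r)
  have g0: "integral (cbox a b) g = 0" for a b
  proof -
    have "integral (cbox a b) g = (LINT z:cbox a b|lborel. g z)"
      using set_borel_integral_eq_integral(2)[OF set_g] by simp
    also have "\<dots> = (LINT z:cbox a b|lborel. h z) - (LINT z:cbox a b|lborel. regular z)"
      unfolding g_def by (intro set_integral_diff set_h set_r)
    also have "\<dots> = 0"
      by (simp add: set_lebesgue_integral_def integral_cbox_regular)
    finally show ?thesis .
  qed
  have "g integrable_on cbox a b" for a b
    using set_borel_integral_eq_integral(1)[OF set_g] .
  then obtain N where N: "negligible N"
    "\<And>x e. \<lbrakk>x \<notin> N; 0 < e\<rbrakk> \<Longrightarrow> \<exists>d>0. \<forall>h. 0 < h \<and> h < d \<longrightarrow>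
       norm (integral (cbox x (x + h *\<^sub>R One)) g /\<^sub>R h ^ DIM(complex) - g x) < e"
    using integrable_ccontinuous_explicit[of g] by metis
  have "g x = 0" if xN: "x \<notin> N" for x
  proof (rule ccontr)
    assume "g x \<noteq> 0"
    then obtain d where "d > 0" and d: "\<forall>h. 0 < h \<and> h < d \<longrightarrow>
        norm (integral (cbox x (x + h *\<^sub>R One)) g /\<^sub>R h ^ DIM(complex) - g x) < norm (g x)"
      using N(2)[OF xN, of "norm (g x)"] by auto
    then show False
      using d[rule_format, of "d / 2"] by (simp add: g0)
  qed
  then have "AE z in lebesgue. g z = 0"
    using N(1) AE_not_in[of N lebesgue] by (auto simp: negligible_iff_null_sets elim: eventually_mono)
  then have "AE z in lborel. g z = 0"
    by (simp add: AE_completion_iff)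
  then show ?thesis
    by (simp add: g_def)
qed

end

section \<open>Differentiable solutions are weak solutions\<close>

lemma bounded_if_continuous_support:
  fixes f :: "complex \<Rightarrow> complex"
  assumes "continuous_on UNIV f" "\<And>z. norm z > r \<Longrightarrow> f z = 0"
  obtains M where "\<And>z. norm (f z) \<le> M"
proof -
  obtain M where M: "\<And>z. z \<in> cball 0 r \<Longrightarrow> norm (f z) \<le> M"
    using compact_imp_bounded[OF compact_continuous_image[OF continuous_on_subset[OF assms(1)] compact_cball[of 0 r]]]
    unfolding bounded_iff by blast
  have "norm (f z) \<le> max M 0" for z
    using M[of z] assms(2)[of z] by (cases "norm z > r") force+
  then show ?thesis ..
qed

lemma integrable_continuous_support:
  fixes f :: "complex \<Rightarrow> complex"
  assumes "continuous_on UNIV f" "\<And>z. norm z > r \<Longrightarrow> f z = 0"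
  shows "integrable lborel f"
proof -
  obtain M where "\<And>z. norm (f z) \<le> M"
    using bounded_if_continuous_support[OF assms] by blast
  then show ?thesis
    using assms by (intro integrable_lborel_bounded_support borel_measurable_continuous_onI)
qed

lemma has_derivative_eq_0_outside:
  fixes f :: "'a::real_normed_vector \<Rightarrow> 'b::real_normed_vector"
  assumes "(f has_derivative D) (at z)" "\<And>z. norm z > r \<Longrightarrow> f z = 0" "norm z > r"
  shows "D v = 0"
proof -
  have "((\<lambda>_. 0) has_derivative D) (at z)"
    by (rule has_derivative_transform_within_open[OF assms(1), of "- cball 0 r"]) (use assms in auto)
  then have "D = (\<lambda>_. 0)"
    by (rule has_derivative_unique) (rule has_derivative_const)
  then show ?thesis by simp
qed

text \<open>The difference quotients have integral zero by translation invariance.\<close>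

lemma integral_directional_derivative_eq_0:
  fixes \<Phi> :: "complex \<Rightarrow> complex"
  assumes D: "\<And>z. (\<Phi> has_derivative D z) (at z)" and cont: "continuous_on UNIV (\<lambda>z. D z v)"
    and supp: "\<And>z. norm z > r \<Longrightarrow> \<Phi> z = 0"
  shows "(\<integral>z. D z v \<partial>lborel) = 0"
proof -
  have cont\<Phi>: "continuous_on UNIV \<Phi>"
    using D by (auto intro!: continuous_at_imp_continuous_on has_derivative_continuous)
  have [measurable]: "\<Phi> \<in> borel_measurable borel" "(\<lambda>z. D z v) \<in> borel_measurable borel"
    by (intro borel_measurable_continuous_onI cont cont\<Phi>)+
  have Dsupp: "D z v = 0" if "norm z > r" for z
    by (rule has_derivative_eq_0_outside[OF D supp that])
  obtain M where M: "\<And>z. norm (D z v) \<le> M"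
    using bounded_if_continuous_support[OF cont Dsupp] by blast
  have "M \<ge> 0"
    using M[of 0] norm_ge_zero order_trans by blast
  have int\<Phi>: "integrable lborel \<Phi>"
    using integrable_continuous_support[OF cont\<Phi> supp] .
  \<comment> \<open>Step sizes of at most 1 keep the supports of all difference quotients in one
    ball, which together with the mean value inequality gives an integrable majorant.\<close>
  define t where "t n = 1 / real (Suc n)" for n
  have t: "0 < t n" "t n \<le> 1" for n
    by (auto simp: t_def)
  have t_lim: "t \<longlonglongrightarrow> 0"
    using LIMSEQ_inverse_real_of_nat by (simp add: t_def[abs_def] inverse_eq_divide)
  define q where "q n z = (\<Phi> (t n *\<^sub>R v + z) - \<Phi> z) /\<^sub>R t n" for n z
  have line: "((\<lambda>s. \<Phi> (s *\<^sub>R v + z)) has_derivative (\<lambda>h. h *\<^sub>R D (s *\<^sub>R v + z) v)) (at s within S)" for s z S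
  proof -
    have "((\<lambda>s. \<Phi> (s *\<^sub>R v + z)) has_derivative (\<lambda>h. D (s *\<^sub>R v + z) (h *\<^sub>R v))) (at s within S)"
      by (rule has_derivative_compose[OF _ D]) (auto intro!: derivative_eq_intros)
    then show ?thesis
      using linear_scale[OF has_derivative_linear[OF D]] by simp
  qed
  have q_bound: "norm (q n z) \<le> M" for n z
  proof -
    have "norm (\<Phi> (t n *\<^sub>R v + z) - \<Phi> (0 *\<^sub>R v + z)) \<le> M * norm (t n - 0)"
    proof (rule differentiable_bound[OF convex_UNIV line])
      show "onorm (\<lambda>h. h *\<^sub>R D (x *\<^sub>R v + z) v) \<le> M" for x
        using M[of "x *\<^sub>R v + z"] by (intro onorm_le) (simp add: mult.commute[of M] mult_left_mono)
    qed auto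
    then show ?thesis
      using t[of n] by (simp add: q_def inverse_eq_divide pos_divide_le_eq)
  qed
  have "(\<lambda>n. \<integral>z. q n z \<partial>lborel) \<longlonglongrightarrow> (\<integral>z. D z v \<partial>lborel)"
  proof (rule integral_dominated_convergence[where w="\<lambda>z. M * indicator (cball 0 (r + norm v)) z"])
    show "integrable lborel (\<lambda>z::complex. M * indicator (cball 0 (r + norm v)) z)"
      by (intro integrable_mult_right integrable_real_indicator emeasure_lborel_cball_finite) auto
    have "norm (q n z) \<le> M * indicator (cball 0 (r + norm v)) z" for n z
    proof (cases "norm z > r + norm v")
      case True
      have "norm (t n *\<^sub>R v) \<le> norm v"
        using t[of n] by (simp add: mult_left_le_one_le)
      then have "norm (t n *\<^sub>R v + z) > r"
        using norm_triangle_ineq2[of z "- (t n *\<^sub>R v)"] True by (simp add: add.commute)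
      moreover have "norm z > r"
        using True norm_ge_zero[of v] by linarith
      ultimately show ?thesis
        using supp \<open>M \<ge> 0\<close> by (simp add: q_def)
    qed (use q_bound in auto)
    then show "AE z in lborel. norm (q n z) \<le> M * indicator (cball 0 (r + norm v)) z" for n
      by simp
    have "(\<lambda>n. q n z) \<longlonglongrightarrow> D z v" for z
    proof -
      have "((\<lambda>h. norm (\<Phi> (h *\<^sub>R v + z) - \<Phi> z - h *\<^sub>R D z v) / norm h) \<longlongrightarrow> 0) (at 0)"
        using line[of z 0 UNIV] by (simp add: has_derivative_at)
      then have "((\<lambda>h. norm ((\<Phi> (h *\<^sub>R v + z) - \<Phi> z) /\<^sub>R h - D z v)) \<longlongrightarrow> 0) (at 0)"
      proof (rule Lim_transform_eventually)
        have "norm (x - h *\<^sub>R y) / norm h = norm (x /\<^sub>R h - y)" if "h \<noteq> 0" for x y :: complex and h :: real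
        proof -
          have "x /\<^sub>R h - y = (x - h *\<^sub>R y) /\<^sub>R h"
            using that by (simp add: scaleR_diff_right)
          then show ?thesis
            by (simp add: divide_inverse mult.commute)
        qed
        then show "\<forall>\<^sub>F h in at 0. norm (\<Phi> (h *\<^sub>R v + z) - \<Phi> z - h *\<^sub>R D z v) / norm h
            = norm ((\<Phi> (h *\<^sub>R v + z) - \<Phi> z) /\<^sub>R h - D z v)"
          by (auto simp: eventually_at intro!: exI[of _ 1])
      qed
      then have "((\<lambda>h. (\<Phi> (h *\<^sub>R v + z) - \<Phi> z) /\<^sub>R h) \<longlongrightarrow> D z v) (at 0)"
        by (simp only: tendsto_norm_zero_iff flip: Lim_null)
      then show ?thesis
        unfolding q_def by (rule filterlim_compose)
          (use t t_lim in \<open>auto simp: filterlim_at less_imp_neq[symmetric] intro!: always_eventually\<close>)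
    qed
    then show "AE z in lborel. (\<lambda>n. q n z) \<longlonglongrightarrow> D z v"
      by simp
  qed (auto simp: q_def)
  moreover have "(\<integral>z. q n z \<partial>lborel) = 0" for n
    using int\<Phi> integrable_lborel_translate[OF int\<Phi>, of "t n *\<^sub>R v"] integral_lborel_translate[of \<Phi> "t n *\<^sub>R v"]
    by (simp add: q_def)
  ultimately show ?thesis
    by (simp add: LIMSEQ_const_iff)
qed

section \<open>Borel integrands, test functions and integration by parts\<close>

lemma borel_measurable_lebesgueI:
  "f \<in> borel_measurable borel \<Longrightarrow> f \<in> borel_measurable (lebesgue :: 'a::euclidean_space measure)"
  by (rule measurable_completion) simp

lemma integral_lebesgue_eq_lborel:
  fixes f :: "'a::euclidean_space \<Rightarrow> 'b::{banach, second_countable_topology}"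
  shows "f \<in> borel_measurable borel \<Longrightarrow> integral\<^sup>L lebesgue f = integral\<^sup>L lborel f"
  by (rule integral_completion) simp

lemma integrable_lebesgue_iff_lborel:
  fixes f :: "'a::euclidean_space \<Rightarrow> 'b::{banach, second_countable_topology}"
  shows "f \<in> borel_measurable borel \<Longrightarrow> integrable lebesgue f \<longleftrightarrow> integrable lborel f"
  by (rule integrable_completion) simp

lemma test_fun_has_derivative:
  "test_fun \<phi> \<Longrightarrow> (\<phi> has_derivative frechet_derivative \<phi> (at z)) (at z)"
  by (auto simp: test_fun_def frechet_derivative_works[symmetric] dest!: bspec[of _ _ "[]"])

lemma test_fun_continuous:
  assumes "test_fun \<phi>"
  shows "continuous_on S \<phi>" "continuous_on S (\<lambda>z. frechet_derivative \<phi> (at z) 1)"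
    "continuous_on S (\<lambda>z. frechet_derivative \<phi> (at z) \<i>)" "continuous_on S (dbar \<phi>)"
proof -
  have *: "pderivs vs \<phi> differentiable (at z)" if "vs \<in> lists {1, \<i>}" for vs z
    using assms that by (auto simp: test_fun_def)
  have "continuous_on S (pderivs vs \<phi>)" if "vs \<in> lists {1, \<i>}" for vs
    using *[OF that] by (auto intro!: continuous_at_imp_continuous_on differentiable_imp_continuous_within)
  from this[of "[]"] this[of "[1]"] this[of "[\<i>]"]
  show 1: "continuous_on S \<phi>" "continuous_on S (\<lambda>z. frechet_derivative \<phi> (at z) 1)"
    "continuous_on S (\<lambda>z. frechet_derivative \<phi> (at z) \<i>)" by simp_all
  then show "continuous_on S (dbar \<phi>)"
    unfolding dbar_def[abs_def] by (intro continuous_intros) auto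
qed

lemma test_fun_support:
  assumes "test_fun \<phi>"
  obtains r where "\<And>z. norm z > r \<Longrightarrow> \<phi> z = 0" "\<And>z. norm z > r \<Longrightarrow> dbar \<phi> z = 0"
proof -
  have "bounded {z. \<phi> z \<noteq> 0}"
    using assms unfolding test_fun_def by (metis bounded_subset closure_subset compact_imp_bounded)
  then obtain r where r: "\<And>z. \<phi> z \<noteq> 0 \<Longrightarrow> norm z \<le> r"
    by (auto simp: bounded_iff)
  have "frechet_derivative \<phi> (at z) v = 0" if "norm z > r" for z v
    by (rule has_derivative_eq_0_outside[OF test_fun_has_derivative[OF assms] _ that]) (use r in force)
  then have "dbar \<phi> z = 0" if "norm z > r" for z
    using that by (simp add: dbar_def)
  then show ?thesis
    using r that[of r] by force
qed

text \<open>Integration by parts: the directional derivatives of the compactly supported product V *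
  \<phi> integrate to zero. The coefficients \<open>A\<close> and \<open>f\<close> are the
  holomorphic and antiholomorphic derivatives of \<open>V\<close>.\<close>

lemma weak_dbar_if_has_derivative:
  assumes V: "\<And>z. (V has_derivative (\<lambda>v. A z * v + f z * cnj v)) (at z)"
    and cont: "continuous_on UNIV A" "continuous_on UNIV f"
  shows "weak_dbar V f"
  unfolding weak_dbar_def
proof (intro allI impI)
  fix \<phi> assume \<phi>: "test_fun \<phi>"
  obtain r where r: "\<And>z. norm z > r \<Longrightarrow> \<phi> z = 0" "\<And>z. norm z > r \<Longrightarrow> dbar \<phi> z = 0"
    using test_fun_support[OF \<phi>] by blast
  have contV: "continuous_on UNIV V"
    using V by (auto intro!: continuous_at_imp_continuous_on has_derivative_continuous)
  note contI = continuous_intros cont contV test_fun_continuous[OF \<phi>]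
  define D where "D z v = V z * frechet_derivative \<phi> (at z) v + (A z * v + f z * cnj v) * \<phi> z" for z v
  have D: "((\<lambda>z. V z * \<phi> z) has_derivative D z) (at z)" for z
    unfolding D_def by (rule has_derivative_mult[OF V test_fun_has_derivative[OF \<phi>]])
  have c1: "continuous_on UNIV (\<lambda>z. D z 1)" and ci: "continuous_on UNIV (\<lambda>z. D z \<i>)"
    unfolding D_def by (intro contI)+
  have I1: "(\<integral>z. D z 1 \<partial>lborel) = 0" and Ii: "(\<integral>z. D z \<i> \<partial>lborel) = 0"
    by (rule integral_directional_derivative_eq_0[OF D c1, of r] integral_directional_derivative_eq_0[OF D ci, of r]; simp add: r)+
  have D0: "D z v = 0" if "norm z > r" for z v
    by (rule has_derivative_eq_0_outside[OF D _ that]) (simp add: r)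
  \<comment> \<open>In this combination the \<open>A\<close> terms cancel because 1 + i * i = 0,
    while the \<open>f\<close> terms add up because 1 + i * cnj i = 2.\<close>
  have eq: "(D z 1 + \<i> * D z \<i>) / 2 = V z * dbar \<phi> z + f z * \<phi> z" for z
    by (simp add: D_def dbar_def field_simps)
  have "(\<integral>z. (D z 1 + \<i> * D z \<i>) / 2 \<partial>lborel) = 0"
    using integrable_continuous_support[OF c1 D0] integrable_continuous_support[OF ci D0] I1 Ii
    by simp
  then have "(\<integral>z. V z * dbar \<phi> z + f z * \<phi> z \<partial>lborel) = 0"
    by (simp add: eq)
  moreover have "integrable lborel (\<lambda>z. V z * dbar \<phi> z)" "integrable lborel (\<lambda>z. f z * \<phi> z)"
    by (rule integrable_continuous_support[where r=r], intro contI, simp add: r)+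
  ultimately have "(\<integral>z. V z * dbar \<phi> z \<partial>lborel) = - (\<integral>z. f z * \<phi> z \<partial>lborel)"
    by (simp add: add_eq_0_iff2)
  moreover have "(\<lambda>z. V z * dbar \<phi> z) \<in> borel_measurable borel" "(\<lambda>z. f z * \<phi> z) \<in> borel_measurable borel"
    by (intro borel_measurable_continuous_onI contI)+
  ultimately show "integral\<^sup>L lebesgue (\<lambda>z. V z * dbar \<phi> z) = - integral\<^sup>L lebesgue (\<lambda>z. f z * \<phi> z)"
    by (simp add: integral_lebesgue_eq_lborel)
qed

section \<open>The weighted spaces\<close>

lemma wt_nonneg: "0 \<le> wt m z"
  by (simp add: wt_def)

lemma wt_rotate: "norm w = 1 \<Longrightarrow> wt m (w * z) = wt m z"
  by (simp add: wt_def norm_mult)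

lemma borel_measurable_wt [measurable]: "wt m \<in> borel_measurable borel"
  unfolding wt_def[abs_def] by measurable

section \<open>Finiteness and positivity of the moments of the weight\<close>

lemma nn_integral_inverse_1_plus_square_finite:
  "(\<integral>\<^sup>+x. ennreal (1 / (1 + x\<^sup>2)) \<partial>lborel) < \<infinity>"
proof -
  define p where "p x = ennreal (1 / (1 + x\<^sup>2))" for x :: real
  have [measurable]: "p \<in> borel_measurable borel"
    unfolding p_def by measurable
  have half: "(\<integral>\<^sup>+x. p x * indicator {0..} x \<partial>lborel) = ennreal (pi / 2 - arctan 0)"
    unfolding p_def
  proof (rule nn_integral_FTC_atLeast)
    show "DERIV arctan x :> 1 / (1 + x\<^sup>2)" for x
      using DERIV_arctan[of x] by (simp add: inverse_eq_divide)
    show "(arctan \<longlongrightarrow> pi / 2) at_top"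
      by (rule tendsto_arctan_at_top)
  qed auto
  have "(\<integral>\<^sup>+x. p x \<partial>lborel) \<le> (\<integral>\<^sup>+x. p x * indicator {0..} x + p (- x) * indicator {0..} (- x) \<partial>lborel)"
    by (intro nn_integral_mono) (auto simp: p_def split: split_indicator)
  also have "\<dots> = (\<integral>\<^sup>+x. p x * indicator {0..} x \<partial>lborel) + (\<integral>\<^sup>+x. p (- x) * indicator {0..} (- x) \<partial>lborel)"
    by (intro nn_integral_add) auto
  also have "(\<integral>\<^sup>+x. p (- x) * indicator {0..} (- x) \<partial>lborel) = (\<integral>\<^sup>+x. p x * indicator {0..} x \<partial>lborel)"
    by (subst (2) lborel_distr_uminus[symmetric], subst nn_integral_distr) auto
  finally show ?thesis
    unfolding half by (simp add: p_def less_top[symmetric]) (auto simp: top_unique)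
qed

lemma integrable_inverse_1_plus_squares:
  "integrable lborel (\<lambda>z. 1 / (1 + (Re z)\<^sup>2) * (1 / (1 + (Im z)\<^sup>2)))"
proof (rule integrableI_bounded)
  let ?I = "\<integral>\<^sup>+x. ennreal (1 / (1 + x\<^sup>2)) \<partial>lborel"
  have "(\<integral>\<^sup>+z. ennreal (norm (1 / (1 + (Re z)\<^sup>2) * (1 / (1 + (Im z)\<^sup>2)))) \<partial>lborel)
      = (\<integral>\<^sup>+x. \<integral>\<^sup>+y. ennreal (1 / (1 + x\<^sup>2)) * ennreal (1 / (1 + y\<^sup>2)) \<partial>lborel \<partial>lborel)"
    by (subst nn_integral_lborel_complex(1)) (auto simp flip: ennreal_mult)
  also have "\<dots> = ?I * ?I"
    by (simp add: nn_integral_cmult nn_integral_multc)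
  also have "\<dots> < \<infinity>"
    using nn_integral_inverse_1_plus_square_finite by (simp add: ennreal_mult_less_top)
  finally show "(\<integral>\<^sup>+z. ennreal (norm (1 / (1 + (Re z)\<^sup>2) * (1 / (1 + (Im z)\<^sup>2)))) \<partial>lborel) < \<infinity>" .
qed measurable

text \<open>The weight is at most exp (1 - t) = exp 2 * exp (- (1 + t)), which explains exp 2. Two
  extra powers of 1 + t pay for the denominators on the right, and the remaining product of power
  and exponential is a value of \<open>cutoff (k + 2)\<close>, hence at most (k + 2)!.\<close>

lemma norm_power_wt_le:
  assumes "m \<ge> 2"
  shows "norm z ^ k * wt m z \<le> fact (k + 2) * exp 2 * (1 / (1 + (Re z)\<^sup>2) * (1 / (1 + (Im z)\<^sup>2)))"
proof -
  define t where "t = (norm z)\<^sup>2"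
  have t: "t \<ge> 0" by (simp add: t_def)
  \<comment> \<open>Outside the unit disc this is m \<ge> 2; inside, the right-hand side is not
    positive.\<close>
  have "norm z powr m \<ge> t - 1"
  proof (cases "norm z \<ge> 1")
    case True
    then have "norm z powr 2 \<le> norm z powr m"
      using assms by (intro powr_mono) auto
    then show ?thesis
      using True by (simp add: t_def powr_numeral)
  next
    case False
    then have "t \<le> 1"
      by (simp add: t_def power_le_one)
    then show ?thesis
      using powr_ge_zero[of "norm z" m] by linarith
  qed
  then have wt: "wt m z \<le> exp 2 * exp (- (1 + t))"
    by (simp add: wt_def flip: exp_add)
  have "norm z \<le> 1 + t"
    using sum_squares_bound[of "norm z" 1] norm_ge_zero[of z] unfolding t_def power2_eq_square by linarith
  then have "norm z ^ k \<le> (1 + t) ^ k"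
    by (rule power_mono) simp
  then have "norm z ^ k * wt m z \<le> (1 + t) ^ k * (exp 2 * exp (- (1 + t)))"
    using wt wt_nonneg t by (intro mult_mono) auto
  then have "(norm z ^ k * wt m z) * (1 + t)\<^sup>2 \<le> ((1 + t) ^ k * (exp 2 * exp (- (1 + t)))) * (1 + t)\<^sup>2"
    by (rule mult_right_mono) simp
  also have "\<dots> = exp 2 * (exp (- (1 + t)) * (1 + t) ^ (k + 2))"
    by (simp add: power_add power2_eq_square mult_ac)
  also have "exp (- (1 + t)) * (1 + t) ^ (k + 2) = cutoff (k + 2) (1 / (1 + t))"
    using t by (simp add: cutoff_def power_inverse divide_inverse del: power_Suc)
  also have "\<dots> \<le> fact (k + 2)"
    by (rule cutoff_le_fact)
  finally have *: "(norm z ^ k * wt m z) * (1 + t)\<^sup>2 \<le> fact (k + 2) * exp 2"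
    by (simp add: mult.commute)
  have "(1 + (Re z)\<^sup>2) * (1 + (Im z)\<^sup>2) \<le> (1 + t)\<^sup>2"
  proof -
    have "(1 + a) * (1 + b) \<le> (1 + (a + b))\<^sup>2" if "a \<ge> 0" "b \<ge> 0" for a b :: real
      using that by (simp add: power2_eq_square algebra_simps add_nonneg_nonneg)
    then show ?thesis
      by (simp add: t_def cmod_power2)
  qed
  then have "(norm z ^ k * wt m z) * ((1 + (Re z)\<^sup>2) * (1 + (Im z)\<^sup>2)) \<le> (norm z ^ k * wt m z) * (1 + t)\<^sup>2"
    using wt_nonneg by (intro mult_left_mono) auto
  also note *
  finally show ?thesis
    by (simp add: pos_le_divide_eq add_pos_nonneg)
qed

lemma integrable_norm_power_wt:
  assumes "m \<ge> 2"
  shows "integrable lborel (\<lambda>z. norm z ^ k * wt m z)"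
proof (rule Bochner_Integration.integrable_bound[OF integrable_mult_right[OF integrable_inverse_1_plus_squares]])
  show "AE z in lborel. norm (norm z ^ k * wt m z)
      \<le> norm (fact (k + 2) * exp 2 * (1 / (1 + (Re z)\<^sup>2) * (1 / (1 + (Im z)\<^sup>2))))"
    using norm_power_wt_le[OF assms] wt_nonneg by (intro AE_I2) (simp add: abs_of_nonneg)
qed measurable

lemma integrable_wt: "m \<ge> 2 \<Longrightarrow> integrable lborel (wt m)"
  using integrable_norm_power_wt[of m 0] by simp

lemma csq_lborel: "csq m k = (\<integral>z. norm z ^ (2 * k) * wt m z \<partial>lborel)"
  unfolding csq_def by (rule integral_lebesgue_eq_lborel) measurable

lemma csq_pos:
  assumes "m \<ge> 2"
  shows "csq m k > 0"
proof -
  have "csq m k \<noteq> 0"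
  proof
    assume "csq m k = 0"
    then have "AE z in lborel. norm z ^ (2 * k) * wt m z = 0"
      unfolding csq_lborel using integrable_norm_power_wt[OF assms] wt_nonneg
      by (subst (asm) integral_nonneg_eq_0_iff_AE) auto
    moreover have "AE z in lborel. z \<noteq> (0::complex)"
      by (rule AE_lborel_singleton)
    ultimately have "AE z in (lborel :: complex measure). False"
      by eventually_elim (auto simp: wt_def)
    then have "emeasure lborel (UNIV :: complex set) = 0"
      by (subst (asm) AE_iff_measurable[OF _ refl]) auto
    then show False
      by simp
  qed
  moreover have "csq m k \<ge> 0"
    unfolding csq_lborel using wt_nonneg by (intro Bochner_Integration.integral_nonneg) auto
  ultimately show ?thesis by simp
qed

section \<open>Algebra of the weighted norm and inner product\<close>

lemma L2w_borelI:
  assumes "u \<in> borel_measurable borel" "integrable lborel (\<lambda>z. (norm (u z))\<^sup>2 * wt m z)"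
  shows "L2w m u"
  unfolding L2w_def
proof
  show "integrable lebesgue (\<lambda>z. (norm (u z))\<^sup>2 * wt m z)"
    using assms by (subst integrable_lebesgue_iff_lborel) auto
qed (rule borel_measurable_lebesgueI[OF assms(1)])

lemma borel_measurable_lebesgue_wt [measurable]: "wt m \<in> borel_measurable lebesgue"
  by (rule borel_measurable_lebesgueI) simp

lemma L2w_mult_integrable:
  assumes u: "L2w m u" and v: "L2w m v"
  shows "integrable lebesgue (\<lambda>z. u z * cnj (v z) * wt m z)"
proof (rule Bochner_Integration.integrable_bound)
  have [measurable]: "u \<in> borel_measurable lebesgue" "v \<in> borel_measurable lebesgue"
    using u v by (auto simp: L2w_def)
  show "integrable lebesgue (\<lambda>z. (norm (u z))\<^sup>2 * wt m z + (norm (v z))\<^sup>2 * wt m z)"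
    using u v by (auto simp: L2w_def)
  show "(\<lambda>z. u z * cnj (v z) * wt m z) \<in> borel_measurable lebesgue"
    by measurable
  have "norm (u z * cnj (v z) * wt m z) \<le> norm ((norm (u z))\<^sup>2 * wt m z + (norm (v z))\<^sup>2 * wt m z)" for z
  proof -
    have "norm (u z) * norm (v z) \<le> (norm (u z))\<^sup>2 + (norm (v z))\<^sup>2"
      using sum_squares_bound[of "norm (u z)" "norm (v z)"] mult_nonneg_nonneg[OF norm_ge_zero[of "u z"] norm_ge_zero[of "v z"]]
      by linarith
    from mult_right_mono[OF this wt_nonneg[of m z]] show ?thesis
      using wt_nonneg[of m z] by (simp add: norm_mult distrib_right)
  qed
  then show "AE z in lebesgue. norm (u z * cnj (v z) * wt m z) \<le> norm ((norm (u z))\<^sup>2 * wt m z + (norm (v z))\<^sup>2 * wt m z)"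
    by simp
qed

lemma L2w_cmult:
  assumes "L2w m u"
  shows "L2w m (\<lambda>z. c * u z)"
proof -
  have "integrable lebesgue (\<lambda>z. (norm c)\<^sup>2 * ((norm (u z))\<^sup>2 * wt m z))"
    using assms by (auto simp: L2w_def)
  then show ?thesis
    using assms by (auto simp: L2w_def norm_mult power_mult_distrib mult.assoc intro!: borel_measurable_times)
qed

lemma L2w_add:
  assumes u: "L2w m u" and v: "L2w m v"
  shows "L2w m (\<lambda>z. u z + v z)"
  unfolding L2w_def
proof
  have [measurable]: "u \<in> borel_measurable lebesgue" "v \<in> borel_measurable lebesgue"
    using u v by (auto simp: L2w_def)
  show "(\<lambda>z. u z + v z) \<in> borel_measurable lebesgue"
    by measurable
  show "integrable lebesgue (\<lambda>z. (norm (u z + v z))\<^sup>2 * wt m z)"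
  proof (rule Bochner_Integration.integrable_bound)
    show "integrable lebesgue (\<lambda>z. 2 * ((norm (u z))\<^sup>2 * wt m z) + 2 * ((norm (v z))\<^sup>2 * wt m z))"
      using u v by (auto simp: L2w_def)
    have "norm ((norm (u z + v z))\<^sup>2 * wt m z) \<le> norm (2 * ((norm (u z))\<^sup>2 * wt m z) + 2 * ((norm (v z))\<^sup>2 * wt m z))" for z
    proof -
      have "(norm (u z + v z))\<^sup>2 \<le> (norm (u z) + norm (v z))\<^sup>2"
        by (intro power_mono norm_triangle_ineq) simp
      also have "\<dots> \<le> 2 * (norm (u z))\<^sup>2 + 2 * (norm (v z))\<^sup>2"
        using sum_squares_bound[of "norm (u z)" "norm (v z)"] by (simp add: power2_sum)
      finally show ?thesis
        using mult_right_mono[OF _ wt_nonneg[of m z]] wt_nonneg[of m z] by (fastforce simp: distrib_right mult.assoc)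
    qed
    then show "AE z in lebesgue. norm ((norm (u z + v z))\<^sup>2 * wt m z) \<le> norm (2 * ((norm (u z))\<^sup>2 * wt m z) + 2 * ((norm (v z))\<^sup>2 * wt m z))"
      by simp
  qed measurable
qed

lemma L2w_diff: "L2w m u \<Longrightarrow> L2w m v \<Longrightarrow> L2w m (\<lambda>z. u z - v z)"
  using L2w_add[of m u "\<lambda>z. (-1) * v z"] L2w_cmult[of m v "-1"] by simp

lemma L2w_sum: "(\<And>k. k \<in> S \<Longrightarrow> L2w m (e k)) \<Longrightarrow> L2w m (\<lambda>z. \<Sum>k\<in>S. e k z)"
proof (induction S rule: infinite_finite_induct)
  case (insert k S)
  then show ?case
    using L2w_add[of m "e k" "\<lambda>z. \<Sum>k\<in>S. e k z"] by simp
qed (simp_all add: L2w_def)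

lemma normsq_nonneg: "normsq m u \<ge> 0"
  unfolding normsq_def using wt_nonneg by (intro Bochner_Integration.integral_nonneg) auto

lemma inner_w_self: "inner_w m u u = normsq m u"
  unfolding inner_w_def normsq_def
  by (simp only: complex_norm_square[symmetric] of_real_mult[symmetric] integral_complex_of_real)

lemma inner_w_cnj: "inner_w m v u = cnj (inner_w m u v)"
  unfolding inner_w_def by (subst Bochner_Integration.integral_cnj[symmetric]) (simp add: mult.commute)

lemma inner_w_cmult_left: "inner_w m (\<lambda>z. c * u z) v = c * inner_w m u v"
  unfolding inner_w_def by (simp add: mult.assoc)

lemma inner_w_diff_left:
  assumes "L2w m u" "L2w m u'" "L2w m v"
  shows "inner_w m (\<lambda>z. u z - u' z) v = inner_w m u v - inner_w m u' v"
  using assms unfolding inner_w_def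
  by (subst Bochner_Integration.integral_diff[symmetric]) (auto simp: L2w_mult_integrable left_diff_distrib)

lemma inner_w_diff_right:
  assumes "L2w m u" "L2w m u'" "L2w m v"
  shows "inner_w m v (\<lambda>z. u z - u' z) = inner_w m v u - inner_w m v u'"
  unfolding inner_w_cnj[of m v] inner_w_diff_left[OF assms] by simp

lemma inner_w_sum_left:
  assumes "\<And>k. k \<in> S \<Longrightarrow> L2w m (e k)" "L2w m v"
  shows "inner_w m (\<lambda>z. \<Sum>k\<in>S. e k z) v = (\<Sum>k\<in>S. inner_w m (e k) v)"
  using assms unfolding inner_w_def
  by (subst Bochner_Integration.integral_sum[symmetric]) (auto simp: L2w_mult_integrable sum_distrib_right)

lemma inner_w_sum_right:
  assumes "\<And>k. k \<in> S \<Longrightarrow> L2w m (e k)" "L2w m v"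
  shows "inner_w m v (\<lambda>z. \<Sum>k\<in>S. e k z) = (\<Sum>k\<in>S. inner_w m v (e k))"
  unfolding inner_w_cnj[of m v] by (subst inner_w_sum_left) (auto simp: assms)

lemma inner_w_cmult_right: "inner_w m u (\<lambda>z. c * v z) = cnj c * inner_w m u v"
  unfolding inner_w_cnj[of m u] inner_w_cmult_left by simp

lemma normsq_diff:
  assumes u: "L2w m u" and v: "L2w m v"
  shows "normsq m (\<lambda>z. u z - v z) = normsq m u + normsq m v - 2 * Re (inner_w m u v)"
proof -
  let ?d = "\<lambda>z. u z - v z"
  have "inner_w m ?d ?d = inner_w m u ?d - inner_w m v ?d"
    using assms by (intro inner_w_diff_left L2w_diff)
  also have "inner_w m u ?d = inner_w m u u - inner_w m u v"
    using assms by (intro inner_w_diff_right)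
  also have "inner_w m v ?d = cnj (inner_w m u v) - inner_w m v v"
    using inner_w_diff_right[OF u v v] inner_w_cnj[of m v u] by simp
  finally have "complex_of_real (normsq m ?d) = normsq m u + normsq m v - (inner_w m u v + cnj (inner_w m u v))"
    by (simp add: inner_w_self)
  then have "Re (complex_of_real (normsq m ?d)) = Re (normsq m u + normsq m v - (inner_w m u v + cnj (inner_w m u v)))"
    by (rule arg_cong)
  then show ?thesis
    by simp
qed

lemma normsq_cong_AE:
  assumes "AE z in lebesgue. u z = v z" "u \<in> borel_measurable lebesgue" "v \<in> borel_measurable lebesgue"
  shows "normsq m u = normsq m v"
  unfolding normsq_def using assms by (intro integral_cong_AE) (measurable, auto elim: eventually_mono)

lemma normsq_orthogonal_sum:
  assumes e: "\<And>k. L2w m (e k)" and orth: "\<And>k l. k \<noteq> l \<Longrightarrow> inner_w m (e k) (e l) = 0" and S: "finite S"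
  shows "normsq m (\<lambda>z. \<Sum>k\<in>S. b k * e k z) = (\<Sum>k\<in>S. (norm (b k))\<^sup>2 * normsq m (e k))"
proof -
  let ?p = "\<lambda>z. \<Sum>k\<in>S. b k * e k z"
  have "inner_w m ?p ?p = (\<Sum>k\<in>S. \<Sum>l\<in>S. b k * cnj (b l) * inner_w m (e k) (e l))"
    by (simp add: inner_w_sum_left inner_w_sum_right L2w_sum L2w_cmult e inner_w_cmult_left inner_w_cmult_right sum_distrib_left mult_ac)
  also have "\<dots> = (\<Sum>k\<in>S. \<Sum>l\<in>S. if l = k then of_real ((norm (b k))\<^sup>2 * normsq m (e k)) else 0)"
    by (intro sum.cong refl) (auto simp: orth inner_w_self complex_norm_square simp del: of_real_power)
  also have "\<dots> = of_real (\<Sum>k\<in>S. (norm (b k))\<^sup>2 * normsq m (e k))"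
    using S by simp
  finally show ?thesis
    by (simp only: inner_w_self of_real_eq_iff)
qed

section \<open>Monomials and Taylor coefficients in the weighted space\<close>

lemma inner_w_eq_0_if_rotation:
  assumes [measurable]: "u \<in> borel_measurable borel" "v \<in> borel_measurable borel" and kl: "k \<noteq> l"
    and rot: "\<And>w z. norm w = 1 \<Longrightarrow> u (w * z) * cnj (v (w * z)) = w ^ k * cnj w ^ l * (u z * cnj (v z))"
  shows "inner_w m u v = 0"
proof -
  obtain w :: complex where w: "norm w = 1" "w ^ k * cnj w ^ l \<noteq> 1"
    using ex_unit_power_neq[OF kl] .
  have "(\<integral>z. u z * cnj (v z) * wt m z \<partial>lborel) = 0"
    by (rule integral_eq_0_if_rotation_eigenfunction[OF _ w]) (simp_all add: rot[OF w(1)] wt_rotate[OF w(1)])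
  then show ?thesis
    unfolding inner_w_def by (subst integral_lebesgue_eq_lborel) measurable
qed

lemma L2w_monomial:
  assumes "m \<ge> 2"
  shows "L2w m (\<lambda>z. cnj z ^ j * z ^ k)"
proof (rule L2w_borelI)
  have "(norm (cnj z ^ j * z ^ k))\<^sup>2 = norm z ^ (2 * (j + k))" for z
    by (simp add: norm_mult norm_power power_mult_distrib flip: power_mult power_add)
      (simp add: algebra_simps)
  then show "integrable lborel (\<lambda>z. (norm (cnj z ^ j * z ^ k))\<^sup>2 * wt m z)"
    using integrable_norm_power_wt[OF assms] by simp
qed measurable

lemma L2w_power: "m \<ge> 2 \<Longrightarrow> L2w m (\<lambda>z. z ^ k)"
  using L2w_monomial[of m 0 k] by simp

lemma normsq_power: "normsq m (\<lambda>z. z ^ k) = csq m k"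
  by (simp add: normsq_def csq_def norm_power mult.commute flip: power_mult)

lemma inner_w_power_eq_0: "k \<noteq> l \<Longrightarrow> inner_w m (\<lambda>z. z ^ k) (\<lambda>z. z ^ l) = 0"
  by (rule inner_w_eq_0_if_rotation) (auto simp: power_mult_distrib)

text \<open>Pairing with a monomial reads off a Taylor coefficient for every entire function of the
  space, without an appeal to density of polynomials.\<close>

lemma inner_w_powser_power:
  assumes m: "m \<ge> 2" and g: "L2w m g" "g \<in> borel_measurable borel"
    and b: "\<And>z. (\<lambda>k. b k * z ^ k) sums g z"
  shows "inner_w m g (\<lambda>z. z ^ n) = b n * csq m n"
proof -
  have "integrable lebesgue (\<lambda>z. g z * cnj (z ^ n) * wt m z)"
    by (intro L2w_mult_integrable g L2w_power m)
  moreover have ms: "(\<lambda>z. g z * cnj z ^ n * wt m z) \<in> borel_measurable borel"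
    using g(2) by measurable
  ultimately have int: "integrable lborel (\<lambda>z. g z * cnj z ^ n * wt m z)"
    by (simp add: integrable_lebesgue_iff_lborel)
  have "inner_w m g (\<lambda>z. z ^ n) = (\<integral>z. g z * cnj z ^ n * wt m z \<partial>lborel)"
    by (simp add: inner_w_def integral_lebesgue_eq_lborel[OF ms])
  also have "\<dots> = b n * csq m n"
    unfolding csq_lborel using m
    by (intro integral_powser_radial b int) (auto simp: wt_rotate integrable_wt integrable_norm_power_wt)
  finally show ?thesis .
qed

lemma entire_powser:
  assumes "g holomorphic_on UNIV"
  obtains b where "\<And>z. (\<lambda>k. b k * z ^ k) sums g z"
proof -
  have "(\<lambda>k. (deriv ^^ k) g 0 / fact k * z ^ k) sums g z" for z
    using holomorphic_power_series[of g 0 "norm z + 1" z] assms holomorphic_on_subset by auto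
  then show ?thesis ..
qed

lemma powser_entire:
  assumes "\<And>z. (\<lambda>k. b k * z ^ k) sums g z"
  shows "g holomorphic_on UNIV"
  unfolding holomorphic_on_def
proof
  fix z :: complex
  have "g holomorphic_on ball 0 (norm z + 1)"
    by (rule power_series_holomorphic[where a=b]) (use assms in simp)
  then show "g field_differentiable at z"
    by (rule holomorphic_on_imp_differentiable_at) auto
qed

lemma A2w_borel: "A2w m f \<Longrightarrow> f \<in> borel_measurable borel"
  by (auto simp: A2w_def intro!: borel_measurable_continuous_onI holomorphic_on_imp_continuous_on)

section \<open>Local integrability and minimality of canonical solutions\<close>

lemma ex_borel_AE_eq:
  fixes u :: "complex \<Rightarrow> complex"
  assumes u: "u \<in> borel_measurable lebesgue"
  obtains u' where "u' \<in> borel_measurable borel" "AE z in lborel. u z = u' z"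
proof -
  have "(\<lambda>z. Re (u z)) \<in> borel_measurable lebesgue" "(\<lambda>z. Im (u z)) \<in> borel_measurable lebesgue"
    using u by measurable
  from this[THEN completion_ex_borel_measurable_real]
  obtain p q where pq: "p \<in> borel_measurable borel" "q \<in> borel_measurable borel"
    "AE z in lborel. Re (u z) = p z" "AE z in lborel. Im (u z) = q z"
    by auto
  show ?thesis
  proof (rule that[of "\<lambda>z. complex_of_real (p z) + \<i> * complex_of_real (q z)"])
    show "AE z in lborel. u z = complex_of_real (p z) + \<i> * complex_of_real (q z)"
      using pq(3,4) by eventually_elim (simp add: complex_eq_iff)
  qed (use pq in measurable)
qed

lemma AE_lborel_imp_lebesgue: "AE z in lborel. P z \<Longrightarrow> AE z in lebesgue. P z"
  by (simp add: AE_completion)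

lemma L2w_locally_integrable:
  assumes m: "m \<ge> 0" and u: "L2w m u"
  obtains u' where "locally_integrable u'" "AE z in lebesgue. u z = u' z"
proof -
  have [measurable]: "u \<in> borel_measurable lebesgue"
    using u by (simp add: L2w_def)
  obtain u' where [measurable]: "u' \<in> borel_measurable borel" and "AE z in lborel. u z = u' z"
    using ex_borel_AE_eq[of u] by auto
  then have ae: "AE z in lebesgue. u z = u' z"
    by (intro AE_lborel_imp_lebesgue)
  have [measurable]: "u' \<in> borel_measurable lebesgue"
    by (rule borel_measurable_lebesgueI) simp
  have "integrable lebesgue (\<lambda>z. (norm (u z))\<^sup>2 * wt m z)"
    using u by (simp add: L2w_def)
  also have "?this \<longleftrightarrow> integrable lebesgue (\<lambda>z. (norm (u' z))\<^sup>2 * wt m z)"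
    by (intro integrable_cong_AE) (measurable, use ae in \<open>auto elim: eventually_mono\<close>)
  finally have int: "integrable lborel (\<lambda>z. (norm (u' z))\<^sup>2 * wt m z)"
    by (subst (asm) integrable_lebesgue_iff_lborel) auto
  have "integrable lborel (\<lambda>z. indicator (cball 0 r) z *\<^sub>R u' z)" for r
  proof (rule Bochner_Integration.integrable_bound)
    \<comment> \<open>The reciprocal of a lower bound for the weight on the disc; combined with x
      \<le> 1 + x * x it bounds the function by its weighted square.\<close>
    define R where "R = exp (max r 0 powr m)"
    show "integrable lborel (\<lambda>z. indicator (cball 0 r) z + R * ((norm (u' z))\<^sup>2 * wt m z))"
      by (intro Bochner_Integration.integrable_add integrable_mult_right int integrable_real_indicator
          emeasure_lborel_cball_finite) auto
    have "norm (indicator (cball 0 r) z *\<^sub>R u' z) \<le> norm (indicator (cball 0 r) z + R * ((norm (u' z))\<^sup>2 * wt m z))" for z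
    proof (cases "norm z \<le> r")
      case True
      then have "norm z powr m \<le> max r 0 powr m"
        using m by (intro powr_mono2) auto
      then have "1 \<le> R * wt m z"
        by (simp add: R_def wt_def flip: exp_add)
      then have "(norm (u' z))\<^sup>2 * 1 \<le> (norm (u' z))\<^sup>2 * (R * wt m z)"
        by (rule mult_left_mono) simp
      moreover have "norm (u' z) \<le> 1 + (norm (u' z))\<^sup>2"
        using sum_squares_bound[of "norm (u' z)" 1] norm_ge_zero[of "u' z"] unfolding power2_eq_square by linarith
      ultimately have "norm (u' z) \<le> 1 + R * ((norm (u' z))\<^sup>2 * wt m z)"
        by (simp add: mult_ac)
      then show ?thesis
        using True by simp
    qed simp
    then show "AE z in lborel. norm (indicator (cball 0 r) z *\<^sub>R u' z) \<le> norm (indicator (cball 0 r) z + R * ((norm (u' z))\<^sup>2 * wt m z))"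
      by simp
    show "(\<lambda>z. indicator (cball 0 r) z *\<^sub>R u' z) \<in> borel_measurable lborel"
      by (intro borel_measurable_scaleR borel_measurable_indicator) simp_all
  qed
  then have "locally_integrable u'"
    by unfold_locales auto
  with ae show ?thesis
    using that by blast
qed

lemma borel_measurable_dbar: "test_fun \<phi> \<Longrightarrow> dbar \<phi> \<in> borel_measurable borel"
  by (intro borel_measurable_continuous_onI test_fun_continuous)

lemma locally_integrable_mult_dbar:
  assumes "locally_integrable u" and \<phi>: "test_fun \<phi>"
  shows "integrable lborel (\<lambda>z. u z * dbar \<phi> z)"
proof -
  interpret locally_integrable u by fact
  obtain r where r: "\<And>z. norm z > r \<Longrightarrow> dbar \<phi> z = 0"
    using test_fun_support[OF \<phi>] by blast
  obtain M where "\<And>z. norm (dbar \<phi> z) \<le> M"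
    using bounded_if_continuous_support[OF test_fun_continuous(4)[OF \<phi>] r] by blast
  then show ?thesis
    by (intro integrable_mult_bounded_support borel_measurable_dbar \<phi> r)
qed

lemma L2w_mult_dbar_integrable:
  assumes m: "m \<ge> 0" and u: "L2w m u" and \<phi>: "test_fun \<phi>"
  shows "integrable lebesgue (\<lambda>z. u z * dbar \<phi> z)"
proof -
  obtain u' where u': "locally_integrable u'" and ae: "AE z in lebesgue. u z = u' z"
    using L2w_locally_integrable[OF m u] by blast
  have [measurable]: "u \<in> borel_measurable lebesgue" "u' \<in> borel_measurable borel"
    using u u' by (auto simp: L2w_def locally_integrable_def)
  have [measurable]: "u' \<in> borel_measurable lebesgue" "dbar \<phi> \<in> borel_measurable lebesgue"
    by (auto intro!: borel_measurable_lebesgueI borel_measurable_dbar \<phi>)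
  have "integrable lebesgue (\<lambda>z. u' z * dbar \<phi> z)"
    using locally_integrable_mult_dbar[OF u' \<phi>] borel_measurable_dbar[OF \<phi>]
    by (subst integrable_lebesgue_iff_lborel) auto
  then show ?thesis
    by (rule integrable_cong_AE_imp) (measurable, use ae in \<open>auto elim: eventually_mono\<close>)
qed

lemma weak_dbar_diff:
  assumes m: "m \<ge> 0" and "L2w m u" "L2w m v" "weak_dbar u f" "weak_dbar v g"
    and fg: "continuous_on UNIV f" "continuous_on UNIV g"
  shows "weak_dbar (\<lambda>z. u z - v z) (\<lambda>z. f z - g z)"
  unfolding weak_dbar_def
proof (intro allI impI)
  fix \<phi> assume \<phi>: "test_fun \<phi>"
  obtain r where r: "\<And>z. norm z > r \<Longrightarrow> \<phi> z = 0"
    using test_fun_support[OF \<phi>] by blast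
  have int: "integrable lebesgue (\<lambda>z. f z * \<phi> z)" if f: "continuous_on UNIV f" for f
  proof -
    have "continuous_on UNIV (\<lambda>z. f z * \<phi> z)"
      by (intro continuous_intros f test_fun_continuous \<phi>)
    then show ?thesis
      using integrable_continuous_support[of "\<lambda>z. f z * \<phi> z" r] r
      by (subst integrable_lebesgue_iff_lborel) (auto intro: borel_measurable_continuous_onI)
  qed
  show "integral\<^sup>L lebesgue (\<lambda>z. (u z - v z) * dbar \<phi> z) = - integral\<^sup>L lebesgue (\<lambda>z. (f z - g z) * \<phi> z)"
    using assms(4,5) \<phi> L2w_mult_dbar_integrable[OF m _ \<phi>] assms(2,3) int[OF fg(1)] int[OF fg(2)]
    by (simp add: left_diff_distrib weak_dbar_def)
qed

lemma canonical_sol_diff: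
  assumes m: "m \<ge> 0" and "canonical_sol m f u" "canonical_sol m g v" "A2w m f" "A2w m g"
  shows "canonical_sol m (\<lambda>z. f z - g z) (\<lambda>z. u z - v z)"
  using assms unfolding canonical_sol_def
  by (auto simp: L2w_diff inner_w_diff_left A2w_def intro!: weak_dbar_diff[where m=m] holomorphic_on_imp_continuous_on)

lemma canonical_sol_cmult:
  assumes "canonical_sol m f u"
  shows "canonical_sol m (\<lambda>z. c * f z) (\<lambda>z. c * u z)"
  using assms by (auto simp: canonical_sol_def L2w_cmult inner_w_cmult_left weak_dbar_def mult.assoc)

text \<open>Another solution differs from the canonical one by an entire function in the weighted
  space, to which the canonical solution is orthogonal.\<close>

lemma normsq_canonical_sol_le:
  assumes m: "m \<ge> 0" and u: "canonical_sol m f u" and v: "L2w m v" "weak_dbar v f"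
    and f: "continuous_on UNIV f"
  shows "normsq m u \<le> normsq m v"
proof -
  have Lu: "L2w m u" and orth: "\<And>g. A2w m g \<Longrightarrow> inner_w m u g = 0" and wu: "weak_dbar u f"
    using u by (auto simp: canonical_sol_def)
  define h where "h z = u z - v z" for z
  have Lh: "L2w m h"
    unfolding h_def by (intro L2w_diff Lu v)
  obtain h' where h': "locally_integrable h'" and ae: "AE z in lebesgue. h z = h' z"
    using L2w_locally_integrable[OF m Lh] by blast
  have [measurable]: "h \<in> borel_measurable lebesgue" "h' \<in> borel_measurable borel"
    "u \<in> borel_measurable lebesgue" "v \<in> borel_measurable lebesgue"
    using Lh h' Lu v by (auto simp: L2w_def locally_integrable_def)
  have [measurable]: "h' \<in> borel_measurable lebesgue"
    by (rule borel_measurable_lebesgueI) simp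
  have wh: "weak_dbar h (\<lambda>_. 0)"
    using weak_dbar_diff[OF m Lu v(1) wu v(2) f f] by (simp add: h_def[abs_def])
  have "(\<integral>z. h' z * dbar \<phi> z \<partial>lborel) = 0" if \<phi>: "test_fun \<phi>" for \<phi>
  proof -
    have [measurable]: "dbar \<phi> \<in> borel_measurable borel"
      by (rule borel_measurable_dbar[OF \<phi>])
    then have [measurable]: "dbar \<phi> \<in> borel_measurable lebesgue"
      by (rule borel_measurable_lebesgueI)
    have "(\<integral>z. h' z * dbar \<phi> z \<partial>lborel) = (\<integral>z. h' z * dbar \<phi> z \<partial>lebesgue)"
      by (rule integral_lebesgue_eq_lborel[symmetric]) measurable
    also have "\<dots> = (\<integral>z. h z * dbar \<phi> z \<partial>lebesgue)"
      by (intro integral_cong_AE) (measurable, use ae in \<open>auto elim: eventually_mono\<close>)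
    finally show ?thesis
      using wh \<phi> by (simp add: weak_dbar_def)
  qed
  then interpret weakly_holomorphic h'
    using h' by (simp add: weakly_holomorphic_def weakly_holomorphic_axioms_def)
  have cont: "continuous_on UNIV regular"
    by (intro holomorphic_on_imp_continuous_on regular_holomorphic)
  then have [measurable]: "regular \<in> borel_measurable lebesgue"
    by (intro borel_measurable_lebesgueI borel_measurable_continuous_onI)
  have ae': "AE z in lebesgue. h z = regular z"
    using ae AE_lborel_imp_lebesgue[OF AE_eq_regular] by eventually_elim simp
  have "integrable lebesgue (\<lambda>z. (norm (h z))\<^sup>2 * wt m z)"
    using Lh by (simp add: L2w_def)
  then have "integrable lebesgue (\<lambda>z. (norm (regular z))\<^sup>2 * wt m z)"
    by (rule integrable_cong_AE_imp) (measurable, use ae' in \<open>auto elim: eventually_mono\<close>)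
  \<comment> \<open>\<open>regular\<close> agrees almost everywhere with a difference of two square
    integrable functions, so it is one of the functions to which u is orthogonal.\<close>
  then have A: "A2w m regular"
    by (simp add: A2w_def L2w_def regular_holomorphic)
  have "normsq m v = normsq m (\<lambda>z. u z - regular z)"
  proof (rule normsq_cong_AE)
    show "AE z in lebesgue. v z = u z - regular z"
      using ae' by eventually_elim (simp add: h_def algebra_simps)
  qed measurable
  also have "\<dots> = normsq m u + normsq m regular"
    using A Lu orth[OF A] by (subst normsq_diff) (auto simp: A2w_def)
  finally show ?thesis
    using normsq_nonneg[of m regular] by simp
qed

text \<open>Pointwise convergence and a uniform norm bound suffice, so the orthogonal expansion need
  not be shown to converge in norm.\<close>

lemma L2w_Fatou:
  assumes v: "\<And>n. L2w m (v n)" "\<And>n. normsq m (v n) \<le> B" and lim: "\<And>z. (\<lambda>n. v n z) \<longlonglongrightarrow> w z"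
  shows "L2w m w \<and> normsq m w \<le> B"
proof -
  have [measurable]: "v n \<in> borel_measurable lebesgue" for n
    using v by (simp add: L2w_def)
  have [measurable]: "w \<in> borel_measurable lebesgue"
    by (rule borel_measurable_LIMSEQ_metric[OF _ lim]) simp
  have B: "B \<ge> 0"
    using v(2)[of 0] normsq_nonneg order_trans by blast
  have "(\<integral>\<^sup>+z. ennreal ((norm (w z))\<^sup>2 * wt m z) \<partial>lebesgue)
      = (\<integral>\<^sup>+z. liminf (\<lambda>n. ennreal ((norm (v n z))\<^sup>2 * wt m z)) \<partial>lebesgue)"
  proof (intro nn_integral_cong)
    fix z
    have "(\<lambda>n. ennreal ((norm (v n z))\<^sup>2 * wt m z)) \<longlonglongrightarrow> ennreal ((norm (w z))\<^sup>2 * wt m z)"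
      by (intro tendsto_intros lim)
    then show "ennreal ((norm (w z))\<^sup>2 * wt m z) = liminf (\<lambda>n. ennreal ((norm (v n z))\<^sup>2 * wt m z))"
      by (intro lim_imp_Liminf[symmetric]) auto
  qed
  also have "\<dots> \<le> liminf (\<lambda>n. \<integral>\<^sup>+z. ennreal ((norm (v n z))\<^sup>2 * wt m z) \<partial>lebesgue)"
    by (intro nn_integral_liminf) measurable
  also have "(\<lambda>n. \<integral>\<^sup>+z. ennreal ((norm (v n z))\<^sup>2 * wt m z) \<partial>lebesgue) = (\<lambda>n. ennreal (normsq m (v n)))"
    using v(1) wt_nonneg by (auto simp: fun_eq_iff normsq_def L2w_def intro!: nn_integral_eq_integral)
  also have "liminf (\<lambda>n. ennreal (normsq m (v n))) \<le> liminf (\<lambda>n. ennreal B)"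
    using v(2) by (intro Liminf_mono always_eventually allI ennreal_leI)
  also have "\<dots> = ennreal B"
    by (simp add: Liminf_const)
  finally have le: "(\<integral>\<^sup>+z. ennreal ((norm (w z))\<^sup>2 * wt m z) \<partial>lebesgue) \<le> ennreal B" .
  then have int: "integrable lebesgue (\<lambda>z. (norm (w z))\<^sup>2 * wt m z)"
    using wt_nonneg by (intro integrableI_nonneg) (auto intro: le_less_trans)
  moreover have "ennreal (normsq m w) \<le> ennreal B"
    using le int wt_nonneg by (simp add: normsq_def nn_integral_eq_integral)
  ultimately show ?thesis
    using B by (simp add: L2w_def)
qed

text \<open>The Taylor polynomial \<open>p\<close> satisfies <f, p> = <p, p>, hence the squared norm
  of f - p is that of f minus that of p.\<close>

lemma Bessel_powser:
  assumes m: "m \<ge> 2" and f: "A2w m f" and a: "\<And>z. (\<lambda>k. a k * z ^ k) sums f z"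
  shows "(\<Sum>k<N. (norm (a k))\<^sup>2 * csq m k) \<le> normsq m f"
proof -
  define p where "p z = (\<Sum>k<N. a k * z ^ k)" for z
  have Lf: "L2w m f" and Lp: "L2w m p"
    using f m by (auto simp: A2w_def p_def[abs_def] L2w_sum L2w_cmult L2w_power)
  have np: "normsq m p = (\<Sum>k<N. (norm (a k))\<^sup>2 * csq m k)"
    unfolding p_def by (subst normsq_orthogonal_sum)
      (auto simp: L2w_power m inner_w_power_eq_0 normsq_power)
  have "inner_w m f p = (\<Sum>k<N. cnj (a k) * (a k * csq m k))"
    unfolding p_def using m
    by (simp add: inner_w_sum_right L2w_cmult L2w_power Lf inner_w_cmult_right inner_w_powser_power[OF m Lf A2w_borel[OF f] a])
  also have "\<dots> = of_real (\<Sum>k<N. (norm (a k))\<^sup>2 * csq m k)"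
    by (simp add: complex_norm_square mult_ac del: of_real_power)
  finally have "Re (inner_w m f p) = normsq m p"
    by (simp add: np)
  then show ?thesis
    using normsq_diff[OF Lf Lp] normsq_nonneg[of m "\<lambda>z. f z - p z"] by (simp add: np)
qed

section \<open>Canonical solutions and compactness\<close>

text \<open>The value at \<open>0\<close> is fixed separately, since truncated subtraction would turn the quotient into \<open>1\<close>.\<close>

definition rho :: "real \<Rightarrow> nat \<Rightarrow> real" where
  "rho m k = (if k = 0 then 0 else csq m k / csq m (k - 1))"

definition lam :: "real \<Rightarrow> nat \<Rightarrow> real" where
  "lam m k = csq m (k + 1) / csq m k - rho m k"

text \<open>For k = 0 the truncated exponent does no harm, since its coefficient
  \<open>rho m 0\<close> is 0.\<close>

definition sol :: "real \<Rightarrow> nat \<Rightarrow> complex \<Rightarrow> complex" where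
  "sol m k z = cnj z * z ^ k - of_real (rho m k) * z ^ (k - 1)"

lemma borel_measurable_sol: "sol m k \<in> borel_measurable borel"
  unfolding sol_def[abs_def] by measurable

lemma L2w_sol: "m \<ge> 2 \<Longrightarrow> L2w m (sol m k)"
  unfolding sol_def[abs_def] using L2w_monomial[of m 1 k] by (intro L2w_diff L2w_cmult L2w_power) auto

text \<open>Both terms have rotation weight k - 1, as cnj w is the inverse of w; for k = 0 only cnj
  z is left.\<close>

lemma sol_rotate:
  assumes "norm w = 1"
  shows "sol m k (w * z) = cnj w * w ^ k * sol m k z"
proof (cases k)
  case (Suc j)
  have "cnj w * w = 1"
    using assms complex_norm_square[of w] by (simp add: mult.commute)
  then have "cnj w * w ^ Suc j = w ^ j"
    by (simp flip: mult.assoc)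
  then have q: "cnj w * w ^ k = w ^ j"
    by (simp add: Suc)
  have "sol m k (w * z) = (cnj w * w ^ k) * (cnj z * z ^ k) - rho m k * (w ^ j * z ^ j)"
    by (simp add: sol_def Suc power_mult_distrib mult_ac)
  also have "\<dots> = w ^ j * sol m k z"
    unfolding q by (simp add: sol_def Suc algebra_simps)
  finally show ?thesis
    by (simp only: q)
qed (simp add: sol_def rho_def)

lemma inner_w_sol_eq_0:
  assumes "k \<noteq> l"
  shows "inner_w m (sol m k) (sol m l) = 0"
proof (rule inner_w_eq_0_if_rotation[OF borel_measurable_sol borel_measurable_sol assms])
  fix w z :: complex
  assume w: "norm w = 1"
  then have "cnj w * w = 1"
    using complex_norm_square[of w] by (simp add: mult.commute)
  moreover have "sol m k (w * z) * cnj (sol m l (w * z)) = (cnj w * w) * (w ^ k * cnj w ^ l * (sol m k z * cnj (sol m l z)))"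
    by (simp add: sol_rotate[OF w] mult_ac)
  ultimately show "sol m k (w * z) * cnj (sol m l (w * z)) = w ^ k * cnj w ^ l * (sol m k z * cnj (sol m l z))"
    by simp
qed

text \<open>For k > 0, writing the function as z ^ (k - 1) times the real factor (norm z)^2 - rho
  gives three moments, and rho * \<open>csq m (k - 1)\<close> = \<open>csq m k\<close> collapses the
  last two.\<close>

lemma normsq_sol:
  assumes m: "m \<ge> 2"
  shows "normsq m (sol m k) = csq m k * lam m k"
proof (cases k)
  case 0
  have "normsq m (sol m k) = csq m 1"
    by (simp add: normsq_def csq_def sol_def rho_def 0)
  then show ?thesis
    using csq_pos[OF m, of 0] by (simp add: lam_def rho_def 0)
next
  case (Suc j)
  let ?r = "rho m k"
  have "(norm (sol m k z))\<^sup>2 = norm z ^ (2 * (j + 2)) - 2 * ?r * norm z ^ (2 * (j + 1)) + ?r\<^sup>2 * norm z ^ (2 * j)" for z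
  proof -
    have "sol m k z = z ^ j * (cnj z * z - ?r)"
      by (simp add: sol_def Suc algebra_simps)
    also have "cnj z * z - ?r = of_real ((norm z)\<^sup>2 - ?r)"
      using complex_norm_square[of z] by (simp add: mult.commute)
    finally have "norm (sol m k z) = norm z ^ j * \<bar>(norm z)\<^sup>2 - ?r\<bar>"
      by (simp only: norm_mult norm_power norm_of_real)
    then have "(norm (sol m k z))\<^sup>2 = (norm z ^ j)\<^sup>2 * ((norm z)\<^sup>2 - ?r)\<^sup>2"
      by (simp add: power_mult_distrib)
    also have "\<dots> = norm z ^ (2 * (j + 2)) - 2 * ?r * norm z ^ (2 * (j + 1)) + ?r\<^sup>2 * norm z ^ (2 * j)"
    proof -
      have "(norm z ^ j)\<^sup>2 = ((norm z)\<^sup>2) ^ j"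
        by (simp add: mult.commute flip: power_mult)
      then have p: "norm z ^ (2 * (j + i)) = (norm z ^ j)\<^sup>2 * ((norm z)\<^sup>2) ^ i" for i
        by (simp only: power_mult power_add)
      have "x * (y - c)\<^sup>2 = x * y ^ 2 - 2 * c * (x * y ^ 1) + c\<^sup>2 * (x * y ^ 0)" for x y c :: real
        by (simp add: power2_eq_square algebra_simps)
      then show ?thesis
        using p[of 0] p[of 1] p[of 2] by (simp only: add_0_right)
    qed
    finally show ?thesis .
  qed
  then have "normsq m (sol m k) = (\<integral>z. norm z ^ (2 * (j + 2)) * wt m z - 2 * ?r * (norm z ^ (2 * (j + 1)) * wt m z)
      + ?r\<^sup>2 * (norm z ^ (2 * j) * wt m z) \<partial>lebesgue)"
    unfolding normsq_def by (simp only: left_diff_distrib distrib_right mult.assoc)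
  also have "\<dots> = csq m (j + 2) - 2 * ?r * csq m (j + 1) + ?r\<^sup>2 * csq m j"
  proof -
    have int: "integrable lebesgue (\<lambda>z. norm z ^ k * wt m z)" for k
      using integrable_norm_power_wt[OF m] by (subst integrable_lebesgue_iff_lborel) auto
    have "(\<integral>z. P z - 2 * ?r * Q z + ?r\<^sup>2 * S z \<partial>lebesgue)
        = integral\<^sup>L lebesgue P - 2 * ?r * integral\<^sup>L lebesgue Q + ?r\<^sup>2 * integral\<^sup>L lebesgue S"
      if "integrable lebesgue P" "integrable lebesgue Q" "integrable lebesgue S" for P Q S :: "complex \<Rightarrow> real"
      using that by simp
    from this[OF int int int] show ?thesis
      unfolding csq_def .
  qed
  also have "\<dots> = csq m k * lam m k"
    using csq_pos[OF m, of j] csq_pos[OF m, of "Suc j"]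
    by (simp add: lam_def rho_def Suc field_simps power2_eq_square)
  finally show ?thesis .
qed

text \<open>This is log-convexity of the moments, read off from a squared norm divided by a positive
  moment.\<close>

lemma lam_nonneg: "m \<ge> 2 \<Longrightarrow> lam m k \<ge> 0"
  using normsq_nonneg[of m "sol m k"] csq_pos[of m k] by (simp add: normsq_sol zero_le_mult_iff)

lemma weak_dbar_cnj_mult:
  assumes f: "f holomorphic_on UNIV" and G: "G holomorphic_on UNIV"
  shows "weak_dbar (\<lambda>z. cnj z * f z - G z) f"
proof (rule weak_dbar_if_has_derivative[where A="\<lambda>z. cnj z * deriv f z - deriv G z"])
  fix z
  have "(f has_derivative (*) (deriv f z)) (at z)" "(G has_derivative (*) (deriv G z)) (at z)"
    using f G holomorphic_derivI[of _ UNIV z] by (auto simp: has_field_derivative_def)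
  then show "((\<lambda>z. cnj z * f z - G z) has_derivative
      (\<lambda>v. (cnj z * deriv f z - deriv G z) * v + f z * cnj v)) (at z)"
    by (auto intro!: derivative_eq_intros simp: algebra_simps)
next
  show "continuous_on UNIV (\<lambda>z. cnj z * deriv f z - deriv G z)"
    by (intro continuous_intros holomorphic_on_imp_continuous_on[OF holomorphic_deriv[OF f]]
        holomorphic_on_imp_continuous_on[OF holomorphic_deriv[OF G]] open_UNIV)
qed (rule holomorphic_on_imp_continuous_on[OF f])

text \<open>In the inner product with an entire g, the factor cnj z passes to g as multiplication by
  z and shifts its Taylor coefficients. Both terms of \<open>sol\<close> then see the same
  coefficient of g, and \<open>rho\<close> is the quotient of moments for which they cancel.\<close>

lemma canonical_sol_power:
  assumes m: "m \<ge> 2"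
  shows "canonical_sol m (\<lambda>z. z ^ k) (sol m k)"
  unfolding canonical_sol_def
proof (intro conjI allI impI)
  show "weak_dbar (sol m k) (\<lambda>z. z ^ k)"
    unfolding sol_def[abs_def] by (intro weak_dbar_cnj_mult holomorphic_intros)
  fix g assume g: "A2w m g"
  then have Lg: "L2w m g" and hol: "g holomorphic_on UNIV"
    by (auto simp: A2w_def)
  have [measurable]: "g \<in> borel_measurable borel"
    by (rule A2w_borel[OF g])
  obtain b where b: "\<And>z. (\<lambda>k. b k * z ^ k) sums g z"
    using entire_powser[OF hol] by blast
  \<comment> \<open>The Taylor coefficients of z * g z; the value 0 at index 0 settles the case k =
    0.\<close>
  define b' where "b' k = (case k of 0 \<Rightarrow> 0 | Suc j \<Rightarrow> b j)" for k
  have b': "(\<lambda>k. b' k * z ^ k) sums (z * g z)" for z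
  proof -
    have "(\<lambda>k. b' (Suc k) * z ^ Suc k) sums (z * g z)"
      using sums_mult[OF b[of z], of z] by (simp add: b'_def mult_ac)
    then show ?thesis
      by (subst (asm) sums_Suc_iff) (simp add: b'_def)
  qed
  have int: "integrable lborel (\<lambda>z. z * g z * cnj z ^ k * wt m z)"
  proof -
    have "integrable lebesgue (\<lambda>z. g z * cnj (cnj z ^ 1 * z ^ k) * wt m z)"
      by (intro L2w_mult_integrable Lg L2w_monomial m)
    then show ?thesis
      by (subst (asm) integrable_lebesgue_iff_lborel) (auto simp: mult_ac)
  qed
  have "inner_w m g (\<lambda>z. cnj z * z ^ k) = (\<integral>z. z * g z * cnj z ^ k * wt m z \<partial>lborel)"
    unfolding inner_w_def by (subst integral_lebesgue_eq_lborel) (auto simp: mult_ac)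
  also have "\<dots> = b' k * csq m k"
    unfolding csq_lborel using m
    by (intro integral_powser_radial[OF b'] int) (auto simp: wt_rotate integrable_wt integrable_norm_power_wt)
  finally have 1: "inner_w m g (\<lambda>z. cnj z * z ^ k) = b' k * csq m k" .
  have 2: "inner_w m g (\<lambda>z. rho m k * z ^ (k - 1)) = rho m k * (b (k - 1) * csq m (k - 1))"
    by (simp add: inner_w_cmult_right inner_w_powser_power[OF m Lg _ b])
  have "inner_w m g (sol m k) = b' k * csq m k - rho m k * (b (k - 1) * csq m (k - 1))"
    unfolding sol_def[abs_def] 1[symmetric] 2[symmetric]
    using L2w_monomial[OF m, of 1 k] m by (intro inner_w_diff_right Lg L2w_cmult L2w_power) auto
  also have "\<dots> = 0"
    using csq_pos[OF m, of "k - 1"] by (cases k) (auto simp: b'_def rho_def)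
  finally show "inner_w m (sol m k) g = 0"
    using inner_w_cnj[of m "sol m k" g] by simp
qed (rule L2w_sol[OF m])

text \<open>The partial sums of the orthogonal expansion of the explicit solution are bounded, so by Fatou
  that solution is square integrable.\<close>

lemma normsq_canonical_sol_le_sum:
  assumes m: "m \<ge> 2" and f: "A2w m f" and u: "canonical_sol m f u"
    and a: "\<And>z. (\<lambda>k. a k * z ^ k) sums f z"
    and growth: "\<And>k. rho m k \<le> C * 2 ^ k"
    and B: "\<And>N. (\<Sum>k<N. (norm (a k))\<^sup>2 * csq m k * lam m k) \<le> B"
  shows "normsq m u \<le> B"
proof -
  have rho_nonneg: "rho m k \<ge> 0" for k
    using csq_pos[OF m] by (auto simp: rho_def less_imp_le)
  have hol: "f holomorphic_on UNIV"
    using f by (simp add: A2w_def)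
  define g where "g k = a (Suc k) * rho m (Suc k)" for k
  have "summable (\<lambda>k. g k * z ^ k)" for z
  proof (rule summable_comparison_test')
    \<comment> \<open>The factor 2 absorbs the growth 2 ^ k of \<open>rho\<close>, and adding 1
      makes the base at least 1, so that the additional power in \<open>Suc k\<close> only increases
      the majorant.\<close>
    define r where "r = 2 * (norm z + 1)"
    have "summable (\<lambda>k. norm (a k) * r ^ k)"
      using a by (intro powser_entire_abs_summable) (auto simp: sums_iff r_def)
    then have "summable (\<lambda>k. norm (a (Suc k)) * r ^ Suc k)"
      by (subst summable_Suc_iff)
    then show "summable (\<lambda>k. C * (norm (a (Suc k)) * r ^ Suc k))"
      by (rule summable_mult)
    show "norm (g k * z ^ k) \<le> C * (norm (a (Suc k)) * r ^ Suc k)" for k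
    proof -
      have "norm z ^ k \<le> (norm z + 1) ^ k"
        by (rule power_mono) auto
      also have "\<dots> \<le> (norm z + 1) ^ Suc k"
        by (rule power_increasing) auto
      finally have "rho m (Suc k) * norm z ^ k \<le> (C * 2 ^ Suc k) * (norm z + 1) ^ Suc k"
        using growth[of "Suc k"] rho_nonneg[of "Suc k"] by (intro mult_mono) auto
      from mult_left_mono[OF this, of "norm (a (Suc k))"] show ?thesis
        using rho_nonneg[of "Suc k"]
        by (simp only: g_def r_def norm_mult norm_power norm_of_real abs_of_nonneg power_mult_distrib) (simp add: mult_ac)
    qed
  qed
  then have G: "(\<lambda>k. g k * z ^ k) sums (\<Sum>k. g k * z ^ k)" for z
    by (rule summable_sums)
  define G where "G z = (\<Sum>k. g k * z ^ k)" for z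
  have Ghol: "G holomorphic_on UNIV"
    using G by (intro powser_entire) (simp add: G_def)
  define v where "v z = cnj z * f z - G z" for z
  define s where "s N z = (\<Sum>k<N. a k * sol m k z)" for N z
  have "(\<lambda>N. s N z) \<longlonglongrightarrow> v z" for z
  proof -
    have "(\<lambda>k. a (Suc k) * rho m (Suc k) * z ^ (Suc k - 1)) sums G z"
      using G[of z] by (simp add: g_def G_def)
    \<comment> \<open>The index shift adds a term for k = 0, which vanishes because
      \<open>rho m 0\<close> is 0.\<close>
    then have "(\<lambda>k. a k * rho m k * z ^ (k - 1)) sums G z"
      by (subst (asm) sums_Suc_iff) (simp add: rho_def)
    from sums_diff[OF sums_mult[OF a[of z], of "cnj z"] this]
    show ?thesis
      by (simp add: sums_def s_def v_def sol_def algebra_simps)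
  qed
  moreover have "L2w m (s N)" for N
    unfolding s_def[abs_def] by (intro L2w_sum L2w_cmult L2w_sol m)
  moreover have "normsq m (s N) \<le> B" for N
  proof -
    have "normsq m (s N) = (\<Sum>k<N. (norm (a k))\<^sup>2 * normsq m (sol m k))"
      unfolding s_def[abs_def] by (intro normsq_orthogonal_sum L2w_sol m inner_w_sol_eq_0) auto
    then show ?thesis
      using B[of N] by (simp add: normsq_sol[OF m] mult.assoc)
  qed
  ultimately have v: "L2w m v" "normsq m v \<le> B"
    using L2w_Fatou[of m s B v] by auto
  have "weak_dbar v f"
    unfolding v_def[abs_def] by (intro weak_dbar_cnj_mult hol Ghol)
  then have "normsq m u \<le> normsq m v"
    using m u v(1) hol by (intro normsq_canonical_sol_le[of m f u v] holomorphic_on_imp_continuous_on) auto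
  with v(2) show ?thesis by linarith
qed

section \<open>The two directions of the equivalence\<close>

lemma lam_tendsto_iff:
  "((\<lambda>k. csq m (k + 1) / csq m k - csq m k / csq m (k - 1)) \<longlonglongrightarrow> 0) \<longleftrightarrow> (lam m \<longlonglongrightarrow> 0)"
proof (rule tendsto_cong)
  \<comment> \<open>The two sequences can differ only at k = 0, where truncated subtraction makes
    the second quotient 1 instead of 0.\<close>
  show "\<forall>\<^sub>F k in sequentially. csq m (k + 1) / csq m k - csq m k / csq m (k - 1) = lam m k"
    using eventually_gt_at_top[of 0] by eventually_elim (simp add: lam_def rho_def)
qed

lemma lam_tendsto_0_if_compact:
  assumes m: "m \<ge> 2" and compact: "Sm_compact m"
  shows "lam m \<longlonglongrightarrow> 0"
proof (rule ccontr)
  assume "\<not> lam m \<longlonglongrightarrow> 0"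
  then obtain e where e: "e > 0" and "\<not> (\<forall>\<^sub>F k in sequentially. dist (lam m k) 0 < e)"
    unfolding tendsto_iff by blast
  \<comment> \<open>By nonnegativity of \<open>lam\<close> the absolute value disappears from the
    negated limit, which then says that \<open>lam\<close> is at least e infinitely often.\<close>
  then have "infinite {k. e \<le> lam m k}"
    using lam_nonneg[OF m] unfolding eventually_cofinite[symmetric] cofinite_eq_sequentially[symmetric]
    by (auto simp: eventually_cofinite not_less)
  then obtain s :: "nat \<Rightarrow> nat" where s: "strict_mono s" "\<And>n. e \<le> lam m (s n)"
    using infinite_enumerate by blast
  define c where "c k = complex_of_real (1 / sqrt (csq m k))" for k
  have c: "(norm (c k))\<^sup>2 * csq m k = 1" for k
    using csq_pos[OF m, of k] by (simp add: c_def norm_divide power_divide)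
  have normsq_cmult: "normsq m (\<lambda>z. c k * u z) = (norm (c k))\<^sup>2 * normsq m u" for k u
    by (simp add: normsq_def norm_mult power_mult_distrib mult.assoc)
  define f where "f n z = c (s n) * z ^ s n" for n z
  define u where "u n z = c (s n) * sol m (s n) z" for n z
  have "A2w m (f n)" for n
    unfolding A2w_def f_def[abs_def] using m by (auto intro!: holomorphic_intros L2w_cmult L2w_power)
  moreover have "canonical_sol m (f n) (u n)" for n
    unfolding f_def[abs_def] u_def[abs_def] by (intro canonical_sol_cmult canonical_sol_power m)
  moreover have "normsq m (f n) \<le> 1" for n
    unfolding f_def[abs_def] by (simp add: normsq_cmult normsq_power c)
  ultimately obtain r N where r: "strict_mono (r :: nat \<Rightarrow> nat)"
    and N: "\<forall>i\<ge>N. \<forall>j\<ge>N. normsq m (\<lambda>z. u (r i) z - u (r j) z) < e"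
    using compact[unfolded Sm_compact_def, rule_format, of f u] e by blast
  define k l where "k = s (r N)" and "l = s (r (Suc N))"
  have "k \<noteq> l"
    using s(1) r by (simp add: k_def l_def strict_mono_eq)
  have nu: "normsq m (\<lambda>z. c k * sol m k z) = lam m k" for k
    using c[of k] by (simp add: normsq_cmult normsq_sol[OF m] flip: mult.assoc)
  have "normsq m (\<lambda>z. u (r N) z - u (r (Suc N)) z) = lam m k + lam m l"
    unfolding u_def k_def[symmetric] l_def[symmetric]
    using m \<open>k \<noteq> l\<close> by (simp add: normsq_diff L2w_cmult L2w_sol nu inner_w_cmult_left inner_w_cmult_right inner_w_sol_eq_0)
  moreover have "lam m k \<ge> e" "lam m l \<ge> e"
    using s(2) by (auto simp: k_def l_def)
  ultimately show False
    using N[rule_format, of N "Suc N"] e by simp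
qed

lemma compact_if_lam_tendsto_0:
  assumes m: "m \<ge> 2" and lim: "lam m \<longlonglongrightarrow> 0"
  shows "Sm_compact m"
  unfolding Sm_compact_def
proof (intro allI impI, elim conjE exE)
  fix f u :: "nat \<Rightarrow> complex \<Rightarrow> complex" and B0
  assume fu: "\<forall>n. A2w m (f n) \<and> canonical_sol m (f n) (u n)" and "\<forall>n. normsq m (f n) \<le> B0"
  define B where "B = max B0 0"
  have B: "B \<ge> 0" "\<And>n. normsq m (f n) \<le> B"
    using \<open>\<forall>n. normsq m (f n) \<le> B0\<close> by (auto simp: B_def max.coboundedI1)
  obtain K where K: "K \<ge> 0" "\<And>k. lam m k \<le> K"
  proof -
    obtain K where "\<And>k. norm (lam m k) \<le> K"
      using convergent_imp_Bseq[OF convergentI[OF lim]] by (auto simp: Bseq_def)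
    then show ?thesis
      using that[of K] lam_nonneg[OF m, of 0] by (metis abs_le_D1 order_trans real_norm_def)
  qed
  \<comment> \<open>\<open>lam\<close> telescopes to \<open>rho\<close>, so a bound on
    \<open>lam\<close> gives linear growth; the cruder exponential bound is all that convergence of
    the correcting series requires.\<close>
  have growth: "rho m k \<le> K * 2 ^ k" for k
  proof (induction k)
    case (Suc k)
    have "rho m (Suc k) = lam m k + rho m k"
      by (simp add: lam_def rho_def)
    also have "\<dots> \<le> K * 2 ^ k + K * 2 ^ k"
      using K(2)[of k] Suc mult_left_mono[OF one_le_power[of "2::real" k] K(1)] by simp
    finally show ?case by simp
  qed (simp add: rho_def K)
  have "\<forall>n. \<exists>a. \<forall>z. (\<lambda>k. a k * z ^ k) sums f n z"
    using fu entire_powser by (metis A2w_def)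
  then obtain a where a: "\<And>n z. (\<lambda>k. a n k * z ^ k) sums f n z"
    by metis
  have csq: "csq m k \<ge> 0" for k
    using csq_pos[OF m, of k] by simp
  \<comment> \<open>Coordinates of f n with respect to the normalised monomials.\<close>
  define F where "F n k = a n k * sqrt (csq m k)" for n k
  have F: "(norm (F n k - F n' k))\<^sup>2 = (norm (a n k - a n' k))\<^sup>2 * csq m k" for n n' k
    using csq[of k] by (simp add: F_def norm_mult power_mult_distrib flip: left_diff_distrib)
  have Bessel: "(\<Sum>k<N. (norm (F n k))\<^sup>2) \<le> B" for n N
    using Bessel_powser[OF m, of "f n" "a n" N] fu a B(2)[of n] csq
    by (simp add: F_def norm_mult power_mult_distrib)
  have F_bound: "norm (F n k) \<le> sqrt B" for n k
  proof (rule real_le_rsqrt)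
    show "(norm (F n k))\<^sup>2 \<le> B"
      using Bessel[where n=n and N="Suc k"] sum_nonneg[of "{..<k}" "\<lambda>k. (norm (F n k))\<^sup>2"] by simp
  qed
  \<comment> \<open>A diagonal argument: each coordinate is bounded by sqrt B, so one subsequence
    makes all of them converge.\<close>
  obtain r where r: "strict_mono (r :: nat \<Rightarrow> nat)" and "\<And>k. \<exists>l. (\<lambda>n. F (r n) k) \<longlonglongrightarrow> l"
    by (rule function_convergent_subsequence[of UNIV F "sqrt B"]) (use F_bound in auto)
  then obtain L where L: "\<And>k. (\<lambda>n. F (r n) k) \<longlonglongrightarrow> L k"
    by metis
  have par: "(norm (x - y))\<^sup>2 \<le> 2 * (norm x)\<^sup>2 + 2 * (norm y)\<^sup>2" for x y :: complex
  proof -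
    have "(norm (x - y))\<^sup>2 \<le> (norm x + norm y)\<^sup>2"
      by (intro power_mono norm_triangle_ineq4) simp
    then show ?thesis
      using sum_squares_bound[of "norm x" "norm y"] by (simp add: power2_sum)
  qed
  have "\<exists>N. \<forall>i\<ge>N. \<forall>j\<ge>N. normsq m (\<lambda>z. u (r i) z - u (r j) z) < e" if e: "e > 0" for e
  proof -
    \<comment> \<open>The tail will contribute at most d * (4 * B), which is at most e / 4; the
      summand 1 keeps the denominator positive when B = 0.\<close>
    define d where "d = e / (16 * (B + 1))"
    have d: "d > 0" "d * (4 * B) \<le> e / 4"
      using e B(1) by (auto simp: d_def field_simps)
    obtain M where M: "\<And>k. k \<ge> M \<Longrightarrow> lam m k \<le> d"
      using order_tendstoD(2)[OF lim d(1)] by (auto simp: eventually_sequentially intro: less_imp_le)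
    \<comment> \<open>The weighted distance of the first M coordinates to their limits, a finite sum
      and therefore convergent to 0.\<close>
    define S where "S i = (\<Sum>k<M. 2 * (norm (F (r i) k - L k))\<^sup>2 * lam m k)" for i
    have "(\<lambda>i. \<Sum>k<M. 2 * (norm (F (r i) k - L k))\<^sup>2 * lam m k) \<longlonglongrightarrow> (\<Sum>k<M. 2 * (norm (L k - L k))\<^sup>2 * lam m k)"
      by (intro tendsto_intros L)
    then have "S \<longlonglongrightarrow> 0"
      by (simp add: S_def[abs_def])
    then obtain N where N: "\<And>i. i \<ge> N \<Longrightarrow> S i < e / 4"
      using order_tendstoD(2)[of S 0 sequentially "e / 4"] e by (auto simp: eventually_sequentially)
    have "normsq m (\<lambda>z. u (r i) z - u (r j) z) < e" if "i \<ge> N" "j \<ge> N" for i j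
    proof -
      define D where "D k = (norm (F (r i) k - F (r j) k))\<^sup>2" for k
      have D: "D k \<ge> 0" for k
        by (simp add: D_def)
      have "(\<Sum>k<n. (norm (a (r i) k - a (r j) k))\<^sup>2 * csq m k * lam m k) \<le> S i + S j + e / 4" for n
      proof -
        \<comment> \<open>Head and tail are split at M: the head is controlled by coordinatewise
          convergence, the tail by lam \<le> d and Bessel's inequality.\<close>
        have "(\<Sum>k<n. D k * lam m k) \<le> (\<Sum>k<n. (if k < M then D k * lam m k else 0) + d * D k)"
        proof (rule sum_mono)
          fix k
          show "D k * lam m k \<le> (if k < M then D k * lam m k else 0) + d * D k"
            using M[of k] D[of k] d(1) by (auto simp: mult.commute[of d] intro!: mult_left_mono)
        qed
        also have "\<dots> = (\<Sum>k\<in>{..<n} \<inter> {..<M}. D k * lam m k) + d * (\<Sum>k<n. D k)"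
          by (simp add: sum.distrib sum_distrib_left sum.If_cases lessThan_def)
        also have "(\<Sum>k\<in>{..<n} \<inter> {..<M}. D k * lam m k) \<le> (\<Sum>k<M. D k * lam m k)"
          using D lam_nonneg[OF m] by (intro sum_mono2) auto
        also have "(\<Sum>k<M. D k * lam m k) \<le> (\<Sum>k<M. 2 * (norm (F (r i) k - L k))\<^sup>2 * lam m k + 2 * (norm (F (r j) k - L k))\<^sup>2 * lam m k)"
        proof (rule sum_mono)
          fix k
          have "D k \<le> 2 * (norm (F (r i) k - L k))\<^sup>2 + 2 * (norm (F (r j) k - L k))\<^sup>2"
            using par[of "F (r i) k - L k" "F (r j) k - L k"] by (simp add: D_def)
          from mult_right_mono[OF this lam_nonneg[OF m, of k]]
          show "D k * lam m k \<le> 2 * (norm (F (r i) k - L k))\<^sup>2 * lam m k + 2 * (norm (F (r j) k - L k))\<^sup>2 * lam m k"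
            by (simp add: distrib_right)
        qed
        also have "\<dots> = S i + S j"
          by (simp add: S_def sum.distrib)
        also have "(\<Sum>k<n. D k) \<le> (\<Sum>k<n. 2 * (norm (F (r i) k))\<^sup>2 + 2 * (norm (F (r j) k))\<^sup>2)"
          unfolding D_def by (intro sum_mono par)
        also have "\<dots> = 2 * (\<Sum>k<n. (norm (F (r i) k))\<^sup>2) + 2 * (\<Sum>k<n. (norm (F (r j) k))\<^sup>2)"
          by (simp add: sum.distrib sum_distrib_left)
        also have "\<dots> \<le> 4 * B"
          using Bessel[of "r i" n] Bessel[of "r j" n] by simp
        finally have "(\<Sum>k<n. D k * lam m k) \<le> S i + S j + d * (4 * B)"
          using d(1) by simp
        then show ?thesis
          using d(2) by (simp add: D_def F)
      qed
      moreover have "A2w m (\<lambda>z. f (r i) z - f (r j) z)"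
        using fu by (auto simp: A2w_def intro!: holomorphic_on_diff L2w_diff)
      moreover have "canonical_sol m (\<lambda>z. f (r i) z - f (r j) z) (\<lambda>z. u (r i) z - u (r j) z)"
        using fu m by (intro canonical_sol_diff) auto
      moreover have "(\<lambda>k. (a (r i) k - a (r j) k) * z ^ k) sums (f (r i) z - f (r j) z)" for z
        using sums_diff[OF a a] by (simp add: left_diff_distrib)
      ultimately have "normsq m (\<lambda>z. u (r i) z - u (r j) z) \<le> S i + S j + e / 4"
        by (intro normsq_canonical_sol_le_sum[OF m _ _ _ growth])
      then show ?thesis
        using N[of i] N[of j] that e by linarith
    qed
    then show ?thesis by blast
  qed
  with r show "\<exists>r :: nat \<Rightarrow> nat. strict_mono r \<and> (\<forall>e>0. \<exists>N. \<forall>i\<ge>N. \<forall>j\<ge>N.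
          normsq m (\<lambda>z. u (r i) z - u (r j) z) < e)"
    by blast
qed

theorem theorem3p1:
  fixes m :: real
  assumes "m \<ge> 2"
  shows "Sm_compact m \<longleftrightarrow>
    ((\<lambda>k. csq m (k + 1) / csq m k - csq m k / csq m (k - 1)) \<longlonglongrightarrow> 0)"
  unfolding lam_tendsto_iff
  using lam_tendsto_0_if_compact[OF assms] compact_if_lam_tendsto_0[OF assms] by blast

end
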